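(* Let $\Omega$ be a domain in $\mathbb{C}$. (1) If $\partial\Omega$ satisfies condition $(U)_{1,\alpha}$ for some $\alpha\in(1,2)$, then there exists $\alpha'>1$ such that $\Omega$ satisfies $(\Delta)_{1,\alpha'}$. Conversely, if $\Omega$ satisfies $(\Delta)_{1,\alpha'}$ for some $\alpha'>1$, then there exists $\alpha>1$ such that $\partial\Omega$ satisfies $(U)_{1,\alpha}$. (2) $\partial\Omega$ satisfies $(U)_{2,\beta}$ for some $\beta>0$ if and only if $\Omega$ satisfies $(\Delta)_{2,\beta'}$ for some $\beta'>0$.
   Context: For an increasing function $h$ on $[0,r_0)$ with $h(r)\le r$, a closed set $K\subset\mathbb{C}$ is $h$-uniformly perfect if $\{z\in\mathbb{C}: h(r)\le|z-a|\le r\}\cap K\neq\emptyset$ for every $a\in K$ and every $r\in(0,r_0)$. Let $h_{1,\alpha}(r)=r^\alpha$ ($\alpha>1$) and $h_{2,\beta}(r)=r(\log\frac1r)^{-\beta}$ ($\beta>0$). A closed set satisfies condition $(U)_{1,\alpha}$ (resp. $(U)_{2,\beta}$) if there exist constants $C>0$ and $r_0>0$ such that it is $Ch_{1,\alpha}$-uniformly perfect (resp. $Ch_{2,\beta}$-uniformly perfect) with that $r_0$. For $a\in\partial\Omega$ and $r>0$, $w_{a,r}$ denotes the harmonic measure of $\Omega\cap\partial D(a,r)$ relative to the open set $\Omega\cap D(a,r)$. For an increasing function $h$, $\Omega$ satisfies condition $(\Delta)_h$ if there exist $\varepsilon\in(0,1)$ and $r_0>0$ such that $w_{a,r}(z)\le1-\varepsilon$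 for every $a\in\partial\Omega$, $r\in(0,r_0)$ and $z\in\Omega\cap\partial D(a,h(r))$. $\Omega$ satisfies $(\Delta)_{1,\alpha}$ (resp. $(\Delta)_{2,\beta}$) if there exists $C>0$ such that $\Omega$ satisfies $(\Delta)_{Ch_{1,\alpha}}$ (resp. $(\Delta)_{Ch_{2,\beta}}$). *)

theory Defs
  imports "HOL-Analysis.Analysis"
begin

definition h_uniformly_perfect :: "(real \<Rightarrow> real) \<Rightarrow> real \<Rightarrow> complex set \<Rightarrow> bool" where
  "h_uniformly_perfect h r0 K \<longleftrightarrow>
     closed K \<and> mono_on {0..<r0} h \<and> (\<forall>r\<in>{0..<r0}. h r \<le> r) \<and>
     (\<forall>a\<in>K. \<forall>r\<in>{0<..<r0}. \<exists>z\<in>K. h r \<le> cmod (z - a) \<and> cmod (z - a) \<le> r)"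

definition h1 :: "real \<Rightarrow> real \<Rightarrow> real" where
  "h1 \<alpha> r = r powr \<alpha>"

definition h2 :: "real \<Rightarrow> real \<Rightarrow> real" where
  "h2 \<beta> r = r * (ln (1 / r)) powr (- \<beta>)"

definition cond_U1 :: "complex set \<Rightarrow> real \<Rightarrow> bool" where
  "cond_U1 K \<alpha> \<longleftrightarrow> (\<exists>C>0. \<exists>r0>0. h_uniformly_perfect (\<lambda>r. C * h1 \<alpha> r) r0 K)"

definition cond_U2 :: "complex set \<Rightarrow> real \<Rightarrow> bool" where
  "cond_U2 K \<beta> \<longleftrightarrow> (\<exists>C>0. \<exists>r0>0. h_uniformly_perfect (\<lambda>r. C * h2 \<beta> r) r0 K)"

definition nonneg_superharmonic_on :: "complex set \<Rightarrow> (complex \<Rightarrow> real) \<Rightarrow> bool" where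
  "nonneg_superharmonic_on U v \<longleftrightarrow>
     (\<forall>z\<in>U. 0 \<le> v z) \<and>
     (\<forall>z\<in>U. \<forall>e>0. \<forall>\<^sub>F w in at z within U. v z - e < v w) \<and>
     (\<forall>z \<rho>. 0 < \<rho> \<and> cball z \<rho> \<subseteq> U \<longrightarrow>
        (\<integral>\<^sup>+ t. ennreal (v (z + complex_of_real \<rho> * cis t)) * indicator {0..2*pi} t \<partial>lborel)
          \<le> ennreal (2 * pi * v z))"

definition perron_upper :: "complex set \<Rightarrow> complex set \<Rightarrow> (complex \<Rightarrow> real) set" where
  "perron_upper U E = {v. nonneg_superharmonic_on U v \<and>
      (\<forall>\<zeta>\<in>frontier U. \<forall>e>0. \<forall>\<^sub>F w in at \<zeta> within U. indicator E \<zeta> - e < v w)}"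

text \<open>Harmonic measure of E relative to the open set U (Perron solution); outside U we
  put the boundary value.\<close>
definition harmonic_measure :: "complex set \<Rightarrow> complex set \<Rightarrow> complex \<Rightarrow> real" where
  "harmonic_measure U E z =
     (if z \<in> U then Inf ((\<lambda>v. v z) ` perron_upper U E) else indicator E z)"

definition w_ar :: "complex set \<Rightarrow> complex \<Rightarrow> real \<Rightarrow> complex \<Rightarrow> real" where
  "w_ar \<Omega> a r = harmonic_measure (\<Omega> \<inter> ball a r) (\<Omega> \<inter> sphere a r)"

definition cond_Delta :: "(real \<Rightarrow> real) \<Rightarrow> complex set \<Rightarrow> bool" where
  "cond_Delta h \<Omega> \<longleftrightarrow> (\<exists>\<epsilon>. 0 < \<epsilon> \<and> \<epsilon> < 1 \<and> (\<exists>r0>0.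
     \<forall>a\<in>frontier \<Omega>. \<forall>r\<in>{0<..<r0}. \<forall>z\<in>\<Omega> \<inter> sphere a (h r). w_ar \<Omega> a r z \<le> 1 - \<epsilon>))"

definition cond_Delta1 :: "complex set \<Rightarrow> real \<Rightarrow> bool" where
  "cond_Delta1 \<Omega> \<alpha> \<longleftrightarrow> (\<exists>C>0. cond_Delta (\<lambda>r. C * h1 \<alpha> r) \<Omega>)"

definition cond_Delta2 :: "complex set \<Rightarrow> real \<Rightarrow> bool" where
  "cond_Delta2 \<Omega> \<beta> \<longleftrightarrow> (\<exists>C>0. cond_Delta (\<lambda>r. C * h2 \<beta> r) \<Omega>)"

end

theory Submission
  imports Defs "HOL-Complex_Analysis.Cauchy_Integral_Formula" "HOL-Real_Asymp.Real_Asymp"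
begin

text \<open>If \<open>\<partial>\<Omega>\<close> misses the annulus \<open>\<rho> \<le> \<bar>z - a\<bar> \<le> r\<close>, then the annulus lies in \<open>\<Omega>\<close> and comparison with the
  harmonic function \<open>ln (\<bar>z - a\<bar> / \<rho>) / ln (r / \<rho>)\<close> bounds the harmonic measure from below. A large
  exponent in the choice of \<open>\<rho>\<close> makes this bound exceed \<open>1 - \<epsilon>\<close> on the circle of radius \<open>h r\<close>.

  Conversely, uniform perfectness yields a binary Cantor set in \<open>\<partial>\<Omega>\<close> near \<open>a\<close>, whose scales satisfy
  \<open>s\<^sub>n\<^sub>+\<^sub>1 = h s\<^sub>n / 8\<close>. The logarithmic potential of its natural measure is harmonic in \<open>\<Omega>\<close> and bounded
  by \<open>\<Sum> 2\<^sup>-\<^sup>n\<^sup>-\<^sup>1 ln (4 / h s\<^sub>n)\<close>, which is finite for \<open>h s = C s\<^sup>\<alpha>\<close> exactly because \<open>\<alpha> < 2\<close>. An affine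
  image of this potential is a competitor in the Perron family, so it bounds the harmonic measure
  from above and no regularity of boundary points is needed.\<close>

section \<open>Circle means and the minimum principle\<close>

text \<open>Dividing by \<open>b = z - w\<close> moves the disc into the right half-plane, where
  \<open>Ln\<close> is holomorphic; Cauchy's formula then gives the mean
  \<open>Ln 1 = 0\<close>.\<close>

lemma ln_cmod_circle_mean:
  fixes z w :: complex
  assumes "0 < \<rho>" "\<rho> < cmod (z - w)"
  shows "((\<lambda>t. ln (cmod (z + of_real \<rho> * cis t - w))) has_integral 2 * pi * ln (cmod (z - w))) {0..2*pi}"
proof -
  define b where "b = z - w"
  have b: "\<rho> < cmod b" "b \<noteq> 0" using assms by (auto simp: b_def)
  have Re: "Re (\<zeta> / b) > 0" if "\<zeta> \<in> cball b \<rho>" for \<zeta>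
  proof -
    have "cmod (1 - \<zeta> / b) = cmod (b - \<zeta>) / cmod b"
      using b by (simp add: norm_divide[symmetric] diff_divide_distrib)
    also have "\<dots> < 1" using that b by (simp add: dist_norm divide_simps)
    finally have "\<bar>Re (1 - \<zeta> / b)\<bar> < 1"
      using abs_Re_le_cmod[of "1 - \<zeta> / b"] by linarith
    then show ?thesis by simp
  qed
  have "(\<lambda>\<zeta>. Ln (\<zeta> / b)) holomorphic_on cball b \<rho>"
    using Re b by (intro holomorphic_intros) (auto simp: complex_nonpos_Reals_iff, fastforce)
  from Cauchy_integral_circlepath_simple[OF this, of b]
  have "((\<lambda>u. Ln (u / b) / (u - b)) has_contour_integral 0) (circlepath b \<rho>)"
    using assms(1) b by simp
  then have "((\<lambda>t. Ln ((b + \<rho> * cis t) / b) / (b + \<rho> * cis t - b) * \<rho> * \<i> * cis t)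
      has_integral 0) {0..2*pi}"
    unfolding circlepath_def by (subst (asm) has_contour_integral_part_circlepath_iff) auto
  \<comment> \<open>The speed of the circle cancels the denominator and leaves \<open>\<i>\<close>
    times the logarithm, whose imaginary part is the real part of \<open>Ln\<close>.\<close>
  from has_integral_linear[OF this bounded_linear_Im]
  have *: "((\<lambda>t. Re (Ln ((b + \<rho> * cis t) / b))) has_integral 0) {0..2*pi}"
    using assms(1) by (simp add: o_def)
  have **: "((\<lambda>t. Re (Ln ((b + \<rho> * cis t) / b)) + ln (cmod b)) has_integral 0 + 2 * pi * ln (cmod b)) {0..2*pi}"
    using has_integral_const_real[of "ln (cmod b)" 0 "2*pi"] by (intro has_integral_add[OF *]) auto
  have eq: "Re (Ln ((b + \<rho> * cis t) / b)) + ln (cmod b) = ln (cmod (z + of_real \<rho> * cis t - w))" for t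
  proof -
    have "b + \<rho> * cis t \<in> cball b \<rho>"
      using assms(1) by (simp add: dist_norm norm_mult)
    then have "b + \<rho> * cis t \<noteq> 0" using Re by fastforce
    then have "Re (Ln ((b + \<rho> * cis t) / b)) + ln (cmod b) = ln (cmod (b + \<rho> * cis t))"
      using b by (simp add: norm_divide ln_div)
    also have "\<dots> = ln (cmod (z + of_real \<rho> * cis t - w))" by (simp add: b_def algebra_simps)
    finally show ?thesis .
  qed
  show ?thesis using ** unfolding eq by (simp add: b_def)
qed

text \<open>The excess \<open>\<rho>\<^sup>2\<close> over the central value makes small multiples of
  the squared modulus usable as strictly submean perturbations of harmonic functions.\<close>

lemma cmod_sq_circle_mean:
  fixes z a :: complex
  shows "((\<lambda>t. (cmod (z + of_real \<rho> * cis t - a))\<^sup>2) has_integral 2 * pi * ((cmod (z - a))\<^sup>2 + \<rho>\<^sup>2)) {0..2*pi}"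
proof -
  define b where "b = z - a"
  define F where "F t = ((cmod b)\<^sup>2 + \<rho>\<^sup>2) * t + 2 * \<rho> * (Re b * sin t - Im b * cos t)" for t
  have eq: "(cmod (z + of_real \<rho> * cis t - a))\<^sup>2
      = (cmod b)\<^sup>2 + \<rho>\<^sup>2 + 2 * \<rho> * (Re b * cos t + Im b * sin t)" for t
  proof -
    have "(cmod (z + of_real \<rho> * cis t - a))\<^sup>2 = (Re b + \<rho> * cos t)\<^sup>2 + (Im b + \<rho> * sin t)\<^sup>2"
      by (simp add: cmod_power2 b_def algebra_simps)
    also have "\<dots> = (Re b)\<^sup>2 + (Im b)\<^sup>2 + \<rho>\<^sup>2 * ((sin t)\<^sup>2 + (cos t)\<^sup>2) + 2 * \<rho> * (Re b * cos t + Im b * sin t)"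
      by (simp only: power2_eq_square) algebra
    finally show ?thesis by (simp add: cmod_power2)
  qed
  have "((\<lambda>t. (cmod b)\<^sup>2 + \<rho>\<^sup>2 + 2 * \<rho> * (Re b * cos t + Im b * sin t)) has_integral F (2*pi) - F 0) {0..2*pi}"
    unfolding F_def
    by (intro fundamental_theorem_of_calculus)
       (auto intro!: derivative_eq_intros simp: has_real_derivative_iff_has_vector_derivative[symmetric])
  moreover have "F (2*pi) - F 0 = 2 * pi * ((cmod (z - a))\<^sup>2 + \<rho>\<^sup>2)"
    by (simp add: F_def b_def)
  ultimately show ?thesis by (simp only: eq)
qed

text \<open>Strict submeanness of the minorant gives a contradiction at any interior minimum of the
  difference, so that no propagation argument along circles is needed.\<close>

lemma minimum_principle_superharmonic:
  assumes sh: "nonneg_superharmonic_on U v" and V: "open V" "bounded V" "V \<subseteq> U"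
    and g: "continuous_on (closure V) g"
    and sub: "\<And>z \<rho>. 0 < \<rho> \<Longrightarrow> cball z \<rho> \<subseteq> V \<Longrightarrow>
        \<exists>I. ((\<lambda>t. g (z + of_real \<rho> * cis t)) has_integral I) {0..2*pi} \<and> 2 * pi * g z < I"
    and bd: "\<And>\<zeta>. \<zeta> \<in> frontier V \<Longrightarrow> \<forall>\<^sub>F w in at \<zeta> within V. g w \<le> v w"
    and z: "z \<in> V"
  shows "g z \<le> v z"
proof (rule ccontr)
  assume "\<not> g z \<le> v z"
  define m where "m = (INF x\<in>V. v x - g x)"
  have v0: "0 \<le> v x" if "x \<in> U" for x
    using sh that by (auto simp: nonneg_superharmonic_on_def)
  have cpt: "compact (closure V)" using V by (simp add: compact_closure)
  have "bdd_above (g ` closure V)"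
    by (intro bounded_imp_bdd_above compact_imp_bounded compact_continuous_image g cpt)
  then obtain M where M: "\<And>x. x \<in> closure V \<Longrightarrow> g x \<le> M" by (auto simp: bdd_above_def)
  have bdd: "bdd_below ((\<lambda>x. v x - g x) ` V)"
    using M v0 V closure_subset[of V] by (intro bdd_belowI2[of _ "-M"]) (smt (verit) subsetD)
  have m_le: "m \<le> v x - g x" if "x \<in> V" for x
    unfolding m_def using bdd that by (rule cINF_lower)
  have "m < 0" using m_le[OF z] \<open>\<not> g z \<le> v z\<close> by linarith
  have "\<exists>x\<in>V. v x - g x < m + 1 / real (Suc n)" for n
  proof -
    have "m < m + 1 / real (Suc n)" by simp
    then show ?thesis
      unfolding m_def using cINF_less_iff[OF _ bdd] z by blast
  qed
  then obtain x where x: "\<And>n. x n \<in> V" "\<And>n. v (x n) - g (x n) < m + 1 / real (Suc n)" by metis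
  have "\<forall>n. x n \<in> closure V" using x(1) closure_subset by blast
  with cpt obtain l k where l: "l \<in> closure V" "strict_mono k" "(x \<circ> k) \<longlonglongrightarrow> l"
    unfolding compact_def by metis
  have small: "\<forall>\<^sub>F n in sequentially. v ((x \<circ> k) n) - g ((x \<circ> k) n) < m + e" if "e > 0" for e
  proof -
    have "\<forall>\<^sub>F n in sequentially. 1 / real (Suc n) < e"
      using that by real_asymp
    then show ?thesis
    proof eventually_elim
      case (elim n)
      have "1 / real (Suc (k n)) \<le> 1 / real (Suc n)"
        using seq_suble[OF l(2), of n] by (simp add: divide_simps)
      then show ?case using x(2)[of "k n"] elim by simp
    qed
  qed
  \<comment> \<open>Members of the sequence may equal \<open>l\<close>, which the punctured filter
    ignores; hence the extra assumption on \<open>P l\<close>.\<close>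
  have along: "\<forall>\<^sub>F n in sequentially. P ((x \<circ> k) n)" if "\<forall>\<^sub>F w in at l within V. P w" "l \<in> V \<Longrightarrow> P l" for P
  proof -
    have "\<forall>\<^sub>F w in nhds l. w \<in> V \<longrightarrow> P w"
      using that(1) unfolding eventually_at_filter by eventually_elim (use that(2) in blast)
    then have "\<forall>\<^sub>F n in sequentially. (x \<circ> k) n \<in> V \<longrightarrow> P ((x \<circ> k) n)"
      using l(3) by (rule eventually_compose_filterlim)
    then show ?thesis using x(1) by simp
  qed
  \<comment> \<open>On the frontier the difference would be eventually nonnegative along the
    sequence, but it tends to \<open>m < 0\<close>.\<close>
  have lV: "l \<in> V"
  proof (rule ccontr)
    assume "l \<notin> V"
    then have "l \<in> frontier V" using l(1) V(1) by (simp add: frontier_def interior_open)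
    from along[OF bd[OF this]] have "\<forall>\<^sub>F n in sequentially. g ((x \<circ> k) n) \<le> v ((x \<circ> k) n)"
      using \<open>l \<notin> V\<close> by blast
    moreover have "\<forall>\<^sub>F n in sequentially. v ((x \<circ> k) n) - g ((x \<circ> k) n) < m + (-m)"
      using \<open>m < 0\<close> by (intro small) auto
    ultimately have "\<forall>\<^sub>F n::nat in sequentially. False" by eventually_elim linarith
    then show False by simp
  qed
  \<comment> \<open>Lower semicontinuity of \<open>v\<close> and continuity of \<open>g\<close> make
    the infimum attained at \<open>l\<close>.\<close>
  have ml: "v l - g l = m"
  proof (rule ccontr)
    assume "v l - g l \<noteq> m"
    define e where "e = (v l - g l - m) / 3"
    have e: "e > 0" using m_le[OF lV] \<open>v l - g l \<noteq> m\<close> by (simp add: e_def)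
    have "\<forall>\<^sub>F w in at l within U. v l - e < v w"
      using sh e lV V(3) by (auto simp: nonneg_superharmonic_on_def)
    then have "\<forall>\<^sub>F w in at l within V. v l - e < v w"
      using V(3) at_le filter_leD by blast
    from along[OF this] e have 1: "\<forall>\<^sub>F n in sequentially. v l - e < v ((x \<circ> k) n)" by simp
    have "(g \<longlongrightarrow> g l) (at l within V)"
      using g l(1) closure_subset[of V] unfolding continuous_on_def by (meson tendsto_within_subset)
    then have "\<forall>\<^sub>F w in at l within V. g w < g l + e"
      using e by (intro order_tendstoD) auto
    from along[OF this] e have 2: "\<forall>\<^sub>F n in sequentially. g ((x \<circ> k) n) < g l + e" by simp
    have "\<forall>\<^sub>F n::nat in sequentially. False"
      using 1 2 small[OF e] by eventually_elim (simp add: e_def field_simps)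
    then show False by simp
  qed
  obtain \<rho> where \<rho>: "\<rho> > 0" "cball l \<rho> \<subseteq> V" using V(1) lV open_contains_cball by blast
  obtain I where I: "((\<lambda>t. g (l + of_real \<rho> * cis t)) has_integral I) {0..2*pi}" "2 * pi * g l < I"
    using sub[OF \<rho>] by blast
  have circ: "l + of_real \<rho> * cis t \<in> V" for t
    using \<rho> by (intro subsetD[OF \<rho>(2)]) (simp add: dist_norm norm_mult)
  \<comment> \<open>The circle mean of \<open>v\<close> is a nonnegative integral and no
    measurability of \<open>v\<close> has been established, so \<open>v\<close> is compared with
    this nonnegative continuous minorant.\<close>
  define G where "G t = max 0 (g (l + of_real \<rho> * cis t) + m)" for t
  have "continuous_on {0..2*pi} (\<lambda>t. g (l + of_real \<rho> * cis t))"
    using circ closure_subset[of V]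
    by (intro continuous_on_compose2[OF g] continuous_intros) auto
  then have "G integrable_on {0..2*pi}"
    unfolding G_def by (intro integrable_continuous_real continuous_intros)
  then obtain J where J: "(G has_integral J) {0..2*pi}" by blast
  have "((\<lambda>t. g (l + of_real \<rho> * cis t) + m) has_integral I + 2 * pi * m) {0..2*pi}"
    using has_integral_const_real[of m 0 "2*pi"] by (intro has_integral_add[OF I(1)]) auto
  then have "I + 2 * pi * m \<le> J"
    using J by (rule has_integral_le) (simp add: G_def)
  moreover have "ennreal J \<le> ennreal (2 * pi * v l)"
  proof -
    have "ennreal J = (\<integral>\<^sup>+ t. ennreal (G t) * indicator {0..2*pi} t \<partial>lborel)"
      by (intro nn_integral_has_integral_lebesgue'[symmetric] J) (simp add: G_def)
    also have "\<dots> \<le> (\<integral>\<^sup>+ t. ennreal (v (l + of_real \<rho> * cis t)) * indicator {0..2*pi} t \<partial>lborel)"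
    proof (intro nn_integral_mono mult_right_mono ennreal_leI)
      show "G t \<le> v (l + of_real \<rho> * cis t)" for t
        using m_le[OF circ[of t]] v0 circ[of t] V(3) by (auto simp: G_def)
    qed auto
    also have "\<dots> \<le> ennreal (2 * pi * v l)"
      using sh \<rho> V(3) unfolding nonneg_superharmonic_on_def by (meson order_trans)
    finally show ?thesis .
  qed
  ultimately have "I + 2 * pi * m \<le> 2 * pi * v l"
    using v0 lV V(3) by (simp add: ennreal_le_iff subset_iff)
  moreover have "2 * pi * v l = 2 * pi * g l + 2 * pi * m" using ml by (simp add: algebra_simps)
  ultimately show False using I(2) by linarith
qed

section \<open>Lower bounds for harmonic measure\<close>

text \<open>Shows that the Perron family is nonempty, so that a lower bound for all its members
  passes to the infimum.\<close>

lemma const_one_in_perron_upper: "(\<lambda>_. 1) \<in> perron_upper U E"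
proof -
  have "(\<integral>\<^sup>+ t. ennreal 1 * indicator {0..2*pi} t \<partial>lborel) \<le> ennreal (2 * pi * 1)"
    by (simp add: nn_integral_cmult_indicator)
  then show ?thesis
    by (auto simp: perron_upper_def nonneg_superharmonic_on_def indicator_def)
qed

text \<open>The function \<open>u\<close> is harmonic with values 0 and 1 on the two circles.
  Lowering it by \<open>\<eta>\<close> and adding a small multiple of the squared modulus gives a
  strictly submean function that lies below every Perron competitor near the boundary of the
  annulus; then \<open>\<eta>\<close> tends to 0.\<close>

lemma harmonic_measure_ge_annulus:
  assumes \<Omega>: "open \<Omega>" and r: "0 < \<rho>" "\<rho> < r"
    and ann: "\<And>z. \<rho> \<le> cmod (z - a) \<Longrightarrow> cmod (z - a) \<le> r \<Longrightarrow> z \<in> \<Omega>"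
    and z: "\<rho> < cmod (z - a)" "cmod (z - a) < r"
  shows "ln (cmod (z - a) / \<rho>) / ln (r / \<rho>) \<le> w_ar \<Omega> a r z"
proof -
  define U where "U = \<Omega> \<inter> ball a r"
  define V where "V = {x. \<rho> < cmod (x - a) \<and> cmod (x - a) < r}"
  define u where "u x = ln (cmod (x - a) / \<rho>) / ln (r / \<rho>)" for x
  have lnpos: "ln (r / \<rho>) > 0" using r by simp
  have zV: "z \<in> V" using z by (simp add: V_def)
  have openV: "open V" unfolding V_def by (intro open_Collect_conj open_Collect_less continuous_intros)
  have bddV: "bounded V"
    by (rule bounded_subset[OF bounded_ball[of a r]]) (auto simp: V_def dist_norm norm_minus_commute)
  have VU: "V \<subseteq> U" using ann by (auto simp: V_def U_def dist_norm norm_minus_commute)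
  have "closed {x. \<rho> \<le> cmod (x - a) \<and> cmod (x - a) \<le> r}"
    by (intro closed_Collect_conj closed_Collect_le continuous_intros)
  then have clV: "closure V \<subseteq> {x. \<rho> \<le> cmod (x - a) \<and> cmod (x - a) \<le> r}"
    by (intro closure_minimal) (auto simp: V_def)
  have zU: "z \<in> U" using zV VU by blast
  have bound: "u z \<le> v z" if v: "v \<in> perron_upper U (\<Omega> \<inter> sphere a r)" for v
  proof (rule field_le_epsilon)
    fix \<eta> :: real assume \<eta>: "\<eta> > 0"
    \<comment> \<open>This makes \<open>\<delta> * r\<^sup>2 = \<eta> / 2\<close>, so the quadratic
      term never outweighs the shift on the closed annulus.\<close>
    define \<delta> where "\<delta> = \<eta> / (2 * r\<^sup>2)"
    have \<delta>: "\<delta> > 0" "\<delta> * r\<^sup>2 < \<eta>" using \<eta> r by (auto simp: \<delta>_def)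
    define g where "g x = u x - \<eta> + \<delta> * (cmod (x - a))\<^sup>2" for x
    have sh: "nonneg_superharmonic_on U v" using v by (simp add: perron_upper_def)
    have gcont: "continuous_on (closure V) g"
      unfolding g_def u_def using clV r lnpos by (intro continuous_intros) auto
    have "g z \<le> v z"
    proof (rule minimum_principle_superharmonic[OF sh openV bddV VU gcont _ _ zV])
      fix x R assume R: "0 < R" "cball x R \<subseteq> V"
      have "a \<notin> cball x R" using R(2) r by (auto simp: V_def)
      then have Rx: "R < cmod (x - a)" by (simp add: dist_norm)
      have circ: "x + of_real R * cis t \<in> V" for t
        using R by (intro subsetD[OF R(2)]) (simp add: dist_norm norm_mult)
      have u_eq: "u y = (ln (cmod (y - a)) - ln \<rho>) / ln (r / \<rho>)" if "y \<in> V" for y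
        using that r by (auto simp: u_def V_def ln_div)
      have "((\<lambda>t. (ln (cmod (x + of_real R * cis t - a)) - ln \<rho>) / ln (r / \<rho>) - \<eta>
            + \<delta> * (cmod (x + of_real R * cis t - a))\<^sup>2) has_integral
          (2 * pi * ln (cmod (x - a)) - 2 * pi * ln \<rho>) / ln (r / \<rho>) - 2 * pi * \<eta>
            + \<delta> * (2 * pi * ((cmod (x - a))\<^sup>2 + R\<^sup>2))) {0..2*pi}"
        using has_integral_const_real[of \<eta> 0 "2*pi"] has_integral_const_real[of "ln \<rho>" 0 "2*pi"]
        by (intro has_integral_add has_integral_diff has_integral_divide has_integral_mult_right
            ln_cmod_circle_mean cmod_sq_circle_mean R Rx) auto
      then have "((\<lambda>t. g (x + of_real R * cis t)) has_integral
          (2 * pi * ln (cmod (x - a)) - 2 * pi * ln \<rho>) / ln (r / \<rho>) - 2 * pi * \<eta>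
            + \<delta> * (2 * pi * ((cmod (x - a))\<^sup>2 + R\<^sup>2))) {0..2*pi}"
        by (simp add: g_def u_eq[OF circ])
      moreover have "x \<in> V" using R by auto
      then have "2 * pi * g x + \<delta> * (2 * pi * R\<^sup>2) =
          (2 * pi * ln (cmod (x - a)) - 2 * pi * ln \<rho>) / ln (r / \<rho>) - 2 * pi * \<eta>
            + \<delta> * (2 * pi * ((cmod (x - a))\<^sup>2 + R\<^sup>2))"
        using lnpos by (simp add: g_def u_eq field_simps)
      moreover have "\<delta> * (2 * pi * R\<^sup>2) > 0" using \<delta> R by simp
      ultimately show "\<exists>I. ((\<lambda>t. g (x + of_real R * cis t)) has_integral I) {0..2*pi} \<and> 2 * pi * g x < I"
        by (metis less_add_same_cancel1)
    next
      fix \<zeta> assume \<zeta>: "\<zeta> \<in> frontier V"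
      then have \<zeta>': "\<rho> \<le> cmod (\<zeta> - a)" "cmod (\<zeta> - a) \<le> r" "\<zeta> \<in> closure V" "\<zeta> \<notin> V"
        using clV openV by (auto simp: frontier_def interior_open)
      have lim: "(g \<longlongrightarrow> g \<zeta>) (at \<zeta> within V)"
        using gcont \<zeta>'(3) closure_subset[of V] unfolding continuous_on_def by (meson tendsto_within_subset)
      consider "cmod (\<zeta> - a) = \<rho>" | "cmod (\<zeta> - a) = r" using \<zeta>' by (force simp: V_def)
      then show "\<forall>\<^sub>F w in at \<zeta> within V. g w \<le> v w"
      proof cases
        \<comment> \<open>The inner circle lies inside \<open>U\<close>, where
          \<open>v \<ge> 0\<close> suffices; the Perron boundary condition enters on the outer
          circle.\<close>
        case 1
        have "\<delta> * \<rho>\<^sup>2 \<le> \<delta> * r\<^sup>2" using r \<delta> by (intro mult_left_mono power_mono) auto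
        then have "\<delta> * \<rho>\<^sup>2 < \<eta>" using \<delta> by linarith
        then have "g \<zeta> < 0" using 1 r by (simp add: g_def u_def)
        then have "\<forall>\<^sub>F w in at \<zeta> within V. g w < 0" using lim by (intro order_tendstoD)
        moreover have "\<forall>\<^sub>F w in at \<zeta> within V. w \<in> V" by (simp add: eventually_at_filter)
        ultimately show ?thesis
        proof eventually_elim
          case (elim w)
          then have "w \<in> U" using VU by blast
          then have "0 \<le> v w" using sh unfolding nonneg_superharmonic_on_def by blast
          then show ?case using elim by linarith
        qed
      next
        case 2
        have g1: "g \<zeta> < 1" using 2 lnpos \<delta> by (simp add: g_def u_def)
        have \<zeta>\<Omega>: "\<zeta> \<in> \<Omega> \<inter> sphere a r"
          using ann \<zeta>' 2 by (simp add: dist_norm norm_minus_commute)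
        have "\<zeta> \<in> closure U" using \<zeta>'(3) closure_mono[OF VU] by blast
        moreover have "\<zeta> \<notin> U" using 2 by (simp add: U_def dist_norm norm_minus_commute)
        moreover have "open U" using \<Omega> by (auto simp: U_def)
        ultimately have "\<zeta> \<in> frontier U" by (simp add: frontier_def interior_open)
        define e where "e = (1 - g \<zeta>) / 2"
        have e: "e > 0" "g \<zeta> < 1 - e" using g1 by (auto simp: e_def field_simps)
        have "\<forall>\<^sub>F w in at \<zeta> within U. indicator (\<Omega> \<inter> sphere a r) \<zeta> - e < v w"
          using v e(1) \<open>\<zeta> \<in> frontier U\<close> unfolding perron_upper_def by blast
        then have "\<forall>\<^sub>F w in at \<zeta> within U. 1 - e < v w" using \<zeta>\<Omega> by simp
        then have "\<forall>\<^sub>F w in at \<zeta> within V. 1 - e < v w" using VU at_le filter_leD by blast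
        moreover have "\<forall>\<^sub>F w in at \<zeta> within V. g w < 1 - e" using lim e by (intro order_tendstoD)
        ultimately show ?thesis by eventually_elim simp
      qed
    qed
    moreover have "u z - \<eta> \<le> g z" using \<delta> by (simp add: g_def)
    ultimately show "u z \<le> v z + \<eta>" by linarith
  qed
  have "u z \<le> (INF v\<in>perron_upper U (\<Omega> \<inter> sphere a r). v z)"
    using const_one_in_perron_upper bound by (intro cINF_greatest) auto
  then show ?thesis
    using zU by (simp add: w_ar_def harmonic_measure_def U_def u_def)
qed

text \<open>The logarithmic hypothesis says that \<open>ln (h / \<rho>) / ln (r / \<rho>)\<close>
  exceeds \<open>1 - \<epsilon>\<close>. An annulus missing the frontier would lie in
  \<open>\<Omega>\<close> and push the harmonic measure above that bound.\<close>

lemma frontier_meets_annulus_of_harmonic_measure: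
  assumes \<Omega>: "open \<Omega>" "connected \<Omega>" and a: "a \<in> frontier \<Omega>"
    and big: "\<not> \<Omega> \<subseteq> ball a \<rho>" and r: "0 < \<rho>" "\<rho> < h" "h < r"
    and w: "\<And>z. z \<in> \<Omega> \<inter> sphere a h \<Longrightarrow> w_ar \<Omega> a r z \<le> 1 - \<epsilon>"
    and ln: "ln (r / h) < \<epsilon> * ln (r / \<rho>)"
  shows "\<exists>z\<in>frontier \<Omega>. \<rho> \<le> cmod (z - a) \<and> cmod (z - a) \<le> r"
proof (rule ccontr)
  define A where "A = {x. \<rho> \<le> cmod (x - a) \<and> cmod (x - a) \<le> r}"
  assume "\<not> ?thesis"
  then have disj: "A \<inter> frontier \<Omega> = {}" by (auto simp: A_def)
  have "connected A" unfolding A_def by (intro connected_annulus) simp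
  with disj have "A \<inter> \<Omega> = {} \<or> A \<subseteq> \<Omega>" using connected_Int_frontier by blast
  \<comment> \<open>\<open>\<Omega>\<close> has points near \<open>a\<close> but is not contained in
    the ball, so by connectedness it crosses the inner circle.\<close>
  moreover have "A \<inter> \<Omega> \<noteq> {}"
  proof -
    have "\<Omega> \<inter> ball a \<rho> \<noteq> {}"
      using a r by (metis Diff_iff centre_in_ball disjoint_iff frontier_def open_Int_closure_eq_empty
          open_ball IntI inf_commute)
    then have "\<Omega> \<inter> frontier (ball a \<rho>) \<noteq> {}"
      using big \<Omega> by (intro connected_Int_frontier) auto
    moreover have "frontier (ball a \<rho>) \<subseteq> A"
      using r by (auto simp: A_def dist_norm norm_minus_commute)
    ultimately show ?thesis by blast
  qed
  ultimately have A\<Omega>: "A \<subseteq> \<Omega>" by blast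
  define z where "z = a + of_real h"
  have z: "cmod (z - a) = h" using r by (simp add: z_def)
  have "z \<in> \<Omega> \<inter> sphere a h"
    using A\<Omega> z r by (auto simp: A_def dist_norm norm_minus_commute)
  from w[OF this] have "w_ar \<Omega> a r z \<le> 1 - \<epsilon>" .
  moreover have "ln (cmod (z - a) / \<rho>) / ln (r / \<rho>) \<le> w_ar \<Omega> a r z"
    using A\<Omega> z r by (intro harmonic_measure_ge_annulus \<Omega>) (auto simp: A_def)
  moreover have "ln (h / \<rho>) / ln (r / \<rho>) > 1 - \<epsilon>"
  proof -
    have "ln (r / \<rho>) > 0" using r by simp
    moreover have "ln (h / \<rho>) = ln (r / \<rho>) - ln (r / h)" using r by (simp add: ln_div)
    ultimately show ?thesis using ln by (simp add: field_simps)
  qed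
  ultimately show False using z by simp
qed

section \<open>Potentials of Cantor sets and upper bounds for harmonic measure\<close>

lemma abs_ln_diff_le:
  fixes x y d :: real
  assumes "0 < d" "d \<le> x" "d \<le> y"
  shows "\<bar>ln x - ln y\<bar> \<le> \<bar>x - y\<bar> / d"
proof -
  have *: "ln x - ln y \<le> \<bar>x - y\<bar> / d" if "d \<le> x" "d \<le> y" for x y
  proof -
    have "ln x - ln y \<le> (x - y) / y" using that assms(1) by (intro ln_diff_le) auto
    also have "\<dots> \<le> \<bar>x - y\<bar> / d" using that assms(1) by (intro frac_le) auto
    finally show ?thesis .
  qed
  show ?thesis using *[of x y] *[of y x] assms by (auto simp: abs_le_iff abs_minus_commute)
qed

text \<open>The function \<open>pot n w s\<close> is the logarithmic potential of \<open>2 ^ n\<close> equal point masses, the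
  \<open>n\<close>-th stage of a Cantor construction inside \<open>K\<close>: a node \<open>w\<close> at scale \<open>s\<close> splits into \<open>w\<close> and
  \<open>c w s\<close> at scale \<open>h s / 8\<close>. The function \<open>B\<close> is a supersolution of the recursion satisfied by
  the maximum of the limiting potential.\<close>

locale cantor_potential =
  fixes K :: "complex set" and h :: "real \<Rightarrow> real" and s0 :: real
    and c :: "complex \<Rightarrow> real \<Rightarrow> complex" and B :: "real \<Rightarrow> real"
  assumes h: "\<And>s. 0 < s \<Longrightarrow> s < s0 \<Longrightarrow> 0 < h s \<and> h s \<le> s"
    and c: "\<And>w s. w \<in> K \<Longrightarrow> 0 < s \<Longrightarrow> s < s0 \<Longrightarrow>
      c w s \<in> K \<and> h s \<le> cmod (c w s - w) \<and> cmod (c w s - w) \<le> s"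
    and B_nonneg: "\<And>s. 0 < s \<Longrightarrow> s < s0 \<Longrightarrow> 0 \<le> B s"
    and B_rec: "\<And>s. 0 < s \<Longrightarrow> s < s0 \<Longrightarrow> (ln (4 / h s) + B (h s / 8)) / 2 \<le> B s"
begin

section \<open>Finite stages: bounds, increments and mean values\<close>

primrec pot :: "nat \<Rightarrow> complex \<Rightarrow> real \<Rightarrow> complex \<Rightarrow> real" where
  "pot 0 w s z = - ln (cmod (z - w))"
| "pot (Suc n) w s z = (pot n w (h s / 8) z + pot n (c w s) (h s / 8) z) / 2"

lemma step:
  assumes "0 < s" "s < s0"
  shows "0 < h s / 8" "h s / 8 < s0" "h s / 8 \<le> s / 8"
  using h[OF assms] assms by auto

lemma dist_child:
  assumes "w \<in> K" "0 < s" "s < s0"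
  shows "\<bar>cmod (z - c w s) - cmod (z - w)\<bar> \<le> s"
proof -
  have "\<bar>cmod (z - c w s) - cmod (z - w)\<bar> \<le> cmod ((z - c w s) - (z - w))"
    by (rule norm_triangle_ineq3)
  also have "\<dots> = cmod (c w s - w)" by (simp add: norm_minus_commute)
  finally show ?thesis using c[OF assms] by linarith
qed

text \<open>Successive displacements are at most \<open>s\<close>, \<open>s / 8\<close>,
  \<open>s / 64\<close> and so on, hence all point masses stay within \<open>2 * s\<close> of
  \<open>w\<close>.\<close>

lemma pot_ge:
  assumes "w \<in> K" "0 < s" "s < s0" "z \<notin> K"
  shows "- ln (cmod (z - w) + 2 * s) \<le> pot n w s z"
  using assms
proof (induction n arbitrary: w s)
  case 0
  then have "cmod (z - w) > 0" by auto
  then have "ln (cmod (z - w)) \<le> ln (cmod (z - w) + 2 * s)" using 0(2) by (intro ln_mono) auto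
  then show ?case by simp
next
  case (Suc n)
  note st = step[OF Suc.prems(2,3)] and dc = dist_child[OF Suc.prems(1-3), of z]
  have "- ln (cmod (z - w) + 2 * s) \<le> - ln (cmod (z - w) + 2 * (h s / 8))"
    using Suc.prems st norm_ge_zero[of "z - w"] by (simp del: norm_ge_zero)
  also have "\<dots> \<le> pot n w (h s / 8) z" using Suc st by blast
  finally have 1: "- ln (cmod (z - w) + 2 * s) \<le> pot n w (h s / 8) z" .
  have "- ln (cmod (z - w) + 2 * s) \<le> - ln (cmod (z - c w s) + 2 * (h s / 8))"
    using Suc.prems st dc norm_ge_zero[of "z - c w s"] by (simp del: norm_ge_zero)
  also have "\<dots> \<le> pot n (c w s) (h s / 8) z" using Suc c st by blast
  finally show ?case using 1 by simp
qed

text \<open>The same localization of the masses, read as a lower bound for their distance to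
  \<open>z\<close>.\<close>

lemma pot_le_far:
  assumes "w \<in> K" "0 < s" "s < s0" "2 * s < cmod (z - w)"
  shows "pot n w s z \<le> - ln (cmod (z - w) - 2 * s)"
  using assms
proof (induction n arbitrary: w s)
  case 0
  then have "ln (cmod (z - w) - 2 * s) \<le> ln (cmod (z - w))" by (intro ln_mono) auto
  then show ?case by simp
next
  case (Suc n)
  note st = step[OF Suc.prems(2,3)] and dc = dist_child[OF Suc.prems(1-3), of z]
  have "pot n w (h s / 8) z \<le> - ln (cmod (z - w) - 2 * (h s / 8))"
    using Suc.prems st by (intro Suc.IH) auto
  also have "\<dots> \<le> - ln (cmod (z - w) - 2 * s)" using Suc.prems st by simp
  finally have 1: "pot n w (h s / 8) z \<le> - ln (cmod (z - w) - 2 * s)" .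
  have "pot n (c w s) (h s / 8) z \<le> - ln (cmod (z - c w s) - 2 * (h s / 8))"
    using Suc.prems st dc c by (intro Suc.IH) auto
  also have "\<dots> \<le> - ln (cmod (z - w) - 2 * s)" using Suc.prems st dc by simp
  finally show ?case using 1 by simp
qed

text \<open>No point can be closer than \<open>h s / 2\<close> to both children of a node, so one of the two halves
  of the measure always contributes at most \<open>ln (4 / h s)\<close>.\<close>

lemma pot_le:
  assumes "w \<in> K" "0 < s" "s < s0" and d: "0 < d" "\<And>x. x \<in> K \<Longrightarrow> d \<le> cmod (z - x)"
  shows "pot n w s z \<le> B s + max 0 (- ln d) / 2 ^ n"
  using assms(1-3)
proof (induction n arbitrary: w s)
  case 0
  have "- ln (cmod (z - w)) \<le> - ln d" using d 0 by (smt (verit) ln_le_cancel_iff)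
  then show ?case using B_nonneg[OF 0(2,3)] by simp
next
  case (Suc n)
  note st = step[OF Suc.prems(2,3)] and hs = h[OF Suc.prems(2,3)] and cw = c[OF Suc.prems]
  \<comment> \<open>The error due to \<open>z\<close> being possibly as close as \<open>d\<close> to
    the set. It is halved at each stage, because the half handled by \<open>near\<close> does not
    carry it.\<close>
  define D where "D = max 0 (- ln d) / 2 ^ n"
  \<comment> \<open>Here the shrinking factor 8 matters: the masses below \<open>y\<close> spread by
    at most \<open>h s / 4\<close>, which leaves them at distance at least \<open>h s / 4\<close>
    from \<open>z\<close>.\<close>
  have near: "pot n y (h s / 8) z \<le> ln (4 / h s)" if "y \<in> K" "h s / 2 \<le> cmod (z - y)" for y
  proof -
    have "pot n y (h s / 8) z \<le> - ln (cmod (z - y) - 2 * (h s / 8))"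
      using that st hs by (intro pot_le_far) auto
    also have "\<dots> \<le> - ln (h s / 4)" using that hs by simp
    also have "\<dots> = ln (4 / h s)" using hs by (simp add: ln_div)
    finally show ?thesis .
  qed
  have IH: "pot n y (h s / 8) z \<le> B (h s / 8) + D" if "y \<in> K" for y
    using Suc.IH[OF that st(1,2)] by (simp add: D_def)
  have "cmod (c w s - w) \<le> cmod (z - w) + cmod (z - c w s)"
    using norm_triangle_ineq4[of "z - w" "z - c w s"] by (simp add: norm_minus_commute)
  then have "h s / 2 \<le> cmod (z - w) \<or> h s / 2 \<le> cmod (z - c w s)" using cw by linarith
  then have "pot n w (h s / 8) z + pot n (c w s) (h s / 8) z \<le> ln (4 / h s) + (B (h s / 8) + D)"
    using near[of w] near[of "c w s"] IH[of w] IH[of "c w s"] cw Suc.prems(1) by linarith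
  then have "pot (Suc n) w s z \<le> B s + D / 2" using B_rec[OF Suc.prems(2,3)] by simp
  then show ?case by (simp add: D_def)
qed

text \<open>From one stage to the next each mass is split in two and one half moves by at most its
  scale, which is at most \<open>s / 8 ^ n\<close>; at distances at least \<open>d\<close> the
  logarithm is Lipschitz with constant \<open>1 / d\<close>.\<close>

lemma pot_diff_le:
  assumes "w \<in> K" "0 < s" "s < s0" and d: "0 < d" "\<And>x. x \<in> K \<Longrightarrow> d \<le> cmod (z - x)"
  shows "\<bar>pot (Suc n) w s z - pot n w s z\<bar> \<le> s / d * (1 / 8) ^ n"
  using assms(1-3)
proof (induction n arbitrary: w s)
  case 0
  have "\<bar>ln (cmod (z - c w s)) - ln (cmod (z - w))\<bar> \<le> \<bar>cmod (z - c w s) - cmod (z - w)\<bar> / d"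
    using c[OF 0] 0 d by (intro abs_ln_diff_le) auto
  also have "\<dots> \<le> s / d" using dist_child[OF 0] d by (intro divide_right_mono) auto
  finally have "\<bar>ln (cmod (z - c w s)) - ln (cmod (z - w))\<bar> \<le> s / d" .
  then show ?case by (simp add: abs_le_iff field_simps)
next
  case (Suc n)
  note st = step[OF Suc.prems(2,3)]
  define e where "e = s / d * (1 / 8) ^ Suc n"
  have "\<bar>pot (Suc n) y (h s / 8) z - pot n y (h s / 8) z\<bar> \<le> e" if "y \<in> K" for y
  proof -
    have "\<bar>pot (Suc n) y (h s / 8) z - pot n y (h s / 8) z\<bar> \<le> (h s / 8) / d * (1 / 8) ^ n"
      using Suc.IH[OF that st(1,2)] .
    also have "\<dots> \<le> (s / 8) / d * (1 / 8) ^ n"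
      using st d by (intro mult_right_mono divide_right_mono) auto
    finally show ?thesis by (simp add: e_def)
  qed
  from this[of w] this[of "c w s"] c[OF Suc.prems] Suc.prems(1)
  have "\<bar>pot (Suc n) w (h s / 8) z - pot n w (h s / 8) z\<bar> \<le> e"
    "\<bar>pot (Suc n) (c w s) (h s / 8) z - pot n (c w s) (h s / 8) z\<bar> \<le> e" by blast+
  moreover have "pot (Suc (Suc n)) w s z - pot (Suc n) w s z =
      ((pot (Suc n) w (h s / 8) z - pot n w (h s / 8) z) +
       (pot (Suc n) (c w s) (h s / 8) z - pot n (c w s) (h s / 8) z)) / 2"
    by (simp add: field_simps)
  moreover have "\<bar>(x + y) / 2\<bar> \<le> e" if "\<bar>x\<bar> \<le> e" "\<bar>y\<bar> \<le> e" for x y :: real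
    using that abs_triangle_ineq[of x y] by simp
  ultimately show ?case unfolding e_def[symmetric] by (simp only:)
qed

lemma continuous_on_pot:
  assumes "w \<in> K" "0 < s" "s < s0" "S \<inter> K = {}"
  shows "continuous_on S (pot n w s)"
  using assms(1-3)
proof (induction n arbitrary: w s)
  case 0
  then show ?case using assms(4) by (auto intro!: continuous_intros)
next
  case (Suc n)
  then show ?case using step[OF Suc.prems(2,3)] c[OF Suc.prems]
    by (auto intro!: continuous_intros)
qed

lemma pot_circle_mean:
  assumes "w \<in> K" "0 < s" "s < s0" "0 < \<rho>" "cball z \<rho> \<inter> K = {}"
  shows "((\<lambda>t. pot n w s (z + of_real \<rho> * cis t)) has_integral 2 * pi * pot n w s z) {0..2*pi}"
  using assms(1-3)
proof (induction n arbitrary: w s)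
  case 0
  then have "w \<notin> cball z \<rho>" using assms(5) by blast
  then have "\<rho> < cmod (z - w)" by (simp add: dist_norm)
  from has_integral_neg[OF ln_cmod_circle_mean[OF assms(4) this]] show ?case by simp
next
  case (Suc n)
  have "((\<lambda>t. (pot n w (h s / 8) (z + of_real \<rho> * cis t) + pot n (c w s) (h s / 8) (z + of_real \<rho> * cis t)) / 2)
      has_integral (2 * pi * pot n w (h s / 8) z + 2 * pi * pot n (c w s) (h s / 8) z) / 2) {0..2*pi}"
    using step[OF Suc.prems(2,3)] c[OF Suc.prems] Suc.prems(1)
    by (intro has_integral_divide has_integral_add Suc.IH) auto
  then show ?case by (simp add: field_simps)
qed

section \<open>The limiting potential and its harmonicity\<close>

definition limit_pot :: "complex \<Rightarrow> real \<Rightarrow> complex \<Rightarrow> real" where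
  "limit_pot w s z = lim (\<lambda>n. pot n w s z)"

text \<open>Taking the limit of the stages replaces a construction of the Cantor measure. The
  geometric bound on increments permits the Weierstrass test for the telescoping sum; stage 0 is
  added back afterwards.\<close>

lemma uniform_limit_pot:
  assumes "w \<in> K" "0 < s" "s < s0" and d: "0 < d" "\<And>z x. z \<in> S \<Longrightarrow> x \<in> K \<Longrightarrow> d \<le> cmod (z - x)"
  shows "uniform_limit S (\<lambda>n. pot n w s) (limit_pot w s) sequentially"
proof -
  have "uniformly_convergent_on S (\<lambda>n z. \<Sum>i<n. pot (Suc i) w s z - pot i w s z)"
  proof (rule Weierstrass_m_test')
    show "norm (pot (Suc n) w s z - pot n w s z) \<le> s / d * (1 / 8) ^ n" if "z \<in> S" for n z
      unfolding real_norm_def by (intro pot_diff_le assms(1-4) d(2)[OF that])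
    show "summable (\<lambda>n. s / d * (1 / 8) ^ n)" by (intro summable_mult summable_geometric) simp
  qed
  moreover have "(\<Sum>i<n. pot (Suc i) w s z - pot i w s z) = pot n w s z - pot 0 w s z" for n z
    by (rule sum_lessThan_telescope)
  ultimately obtain l where "uniform_limit S (\<lambda>n z. pot n w s z - pot 0 w s z) l sequentially"
    unfolding uniformly_convergent_on_def by auto
  then have "uniform_limit S (\<lambda>n z. (pot n w s z - pot 0 w s z) + pot 0 w s z)
      (\<lambda>z. l z + pot 0 w s z) sequentially"
    by (intro uniform_limit_add uniform_limit_const)
  then have "uniformly_convergent_on S (\<lambda>n. pot n w s)"
    unfolding uniformly_convergent_on_def by auto
  then show ?thesis
    unfolding uniformly_convergent_uniform_limit_iff limit_pot_def .
qed

context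
  fixes \<Omega> w s
  assumes open_\<Omega>: "open \<Omega>" and disjoint: "\<Omega> \<inter> K = {}" and w: "w \<in> K" and s: "0 < s" "s < s0"
begin

lemma uniform_limit_pot_compact:
  assumes "compact S" "S \<subseteq> \<Omega>"
  shows "uniform_limit S (\<lambda>n. pot n w s) (limit_pot w s) sequentially"
proof -
  \<comment> \<open>The locale does not say that \<open>K\<close> is closed, so distances are
    measured to \<open>- \<Omega>\<close>, which is closed and contains \<open>K\<close>.\<close>
  have "closed (- \<Omega>)" "S \<inter> - \<Omega> = {}" using open_\<Omega> assms by auto
  with separate_compact_closed[OF assms(1)] obtain d where
    "0 < d" "\<And>x y. x \<in> S \<Longrightarrow> y \<in> - \<Omega> \<Longrightarrow> d \<le> dist x y" by metis
  then show ?thesis using disjoint w s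
    by (intro uniform_limit_pot[of _ _ d]) (auto simp: dist_norm)
qed

lemma pot_tendsto_limit_pot:
  assumes "z \<in> \<Omega>"
  shows "(\<lambda>n. pot n w s z) \<longlonglongrightarrow> limit_pot w s z"
proof -
  have "uniform_limit {z} (\<lambda>n. pot n w s) (limit_pot w s) sequentially"
    using assms by (intro uniform_limit_pot_compact) auto
  then show ?thesis by (rule tendsto_uniform_limitI) simp
qed

lemma isCont_limit_pot:
  assumes "z \<in> \<Omega>"
  shows "isCont (limit_pot w s) z"
proof -
  obtain R where R: "R > 0" "cball z R \<subseteq> \<Omega>" using assms open_\<Omega> open_contains_cball by blast
  have "continuous_on (cball z R) (limit_pot w s)"
  proof (rule uniform_limit_theorem[OF _ uniform_limit_pot_compact])
    show "\<forall>\<^sub>F n in sequentially. continuous_on (cball z R) (pot n w s)"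
      using R disjoint w s by (intro always_eventually allI continuous_on_pot) auto
  qed (use R in auto)
  then show ?thesis using R(1) by (intro continuous_on_interior) auto
qed

text \<open>The mean value property is exact for each stage, and uniform convergence on the compact
  disc carries it to the limit.\<close>

lemma limit_pot_circle_mean:
  assumes R: "0 < R" "cball z R \<subseteq> \<Omega>"
  shows "((\<lambda>t. limit_pot w s (z + of_real R * cis t)) has_integral 2 * pi * limit_pot w s z) {0..2*pi}"
proof -
  have circ: "z + of_real R * cis t \<in> cball z R" for t
    using R by (simp add: dist_norm norm_mult)
  have disj: "cball z R \<inter> K = {}" using R disjoint by blast
  have "uniform_limit {0..2*pi} (\<lambda>n t. pot n w s (z + of_real R * cis t))
      (\<lambda>t. limit_pot w s (z + of_real R * cis t)) sequentially"
    using circ by (intro uniform_limit_compose'[OF uniform_limit_pot_compact[OF compact_cball R(2)]]) auto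
  moreover have "continuous_on {0..2*pi} (\<lambda>t. pot n w s (z + of_real R * cis t))" for n
    using circ by (intro continuous_on_compose2[OF continuous_on_pot[OF w s disj]] continuous_intros) auto
  ultimately obtain I J where IJ:
    "\<And>n. ((\<lambda>t. pot n w s (z + of_real R * cis t)) has_integral I n) {0..2*pi}"
    "((\<lambda>t. limit_pot w s (z + of_real R * cis t)) has_integral J) {0..2*pi}" "I \<longlonglongrightarrow> J"
    by (rule uniform_limit_integral) auto
  have "I = (\<lambda>n. 2 * pi * pot n w s z)"
    using has_integral_unique[OF IJ(1) pot_circle_mean[OF w s R(1) disj]] by auto
  then have "I \<longlonglongrightarrow> 2 * pi * limit_pot w s z"
    using R by (auto intro!: tendsto_intros pot_tendsto_limit_pot)
  then show ?thesis using IJ LIMSEQ_unique by blast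
qed

text \<open>The part of the stage bound that depends on the distance to \<open>K\<close> vanishes as
  \<open>n\<close> grows; what remains holds for \<open>z\<close> arbitrarily close to
  \<open>K\<close>.\<close>

lemma limit_pot_le:
  assumes z: "z \<in> \<Omega>"
  shows "limit_pot w s z \<le> B s"
proof -
  obtain d where d: "d > 0" "ball z d \<subseteq> \<Omega>" using z open_\<Omega> open_contains_ball by blast
  have far: "d \<le> cmod (z - x)" if "x \<in> K" for x
    using that d(2) disjoint by (force simp: dist_norm)
  have "(\<lambda>n. B s + max 0 (- ln d) / 2 ^ n) \<longlonglongrightarrow> B s" by real_asymp
  then show ?thesis
    using pot_le[OF w s d(1) far] by (intro LIMSEQ_le[OF pot_tendsto_limit_pot[OF z]]) auto
qed

lemma limit_pot_ge:
  assumes z: "z \<in> \<Omega>"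
  shows "- ln (cmod (z - w) + 2 * s) \<le> limit_pot w s z"
proof (rule LIMSEQ_le_const[OF pot_tendsto_limit_pot[OF z]])
  have "z \<notin> K" using z disjoint by blast
  then show "\<exists>N. \<forall>n\<ge>N. - ln (cmod (z - w) + 2 * s) \<le> pot n w s z" using pot_ge[OF w s] by blast
qed

lemma limit_pot_le_far:
  assumes z: "z \<in> \<Omega>" "2 * s < cmod (z - w)"
  shows "limit_pot w s z \<le> - ln (cmod (z - w) - 2 * s)"
  using pot_le_far[OF w s z(2)]
  by (intro LIMSEQ_le_const2[OF pot_tendsto_limit_pot[OF z(1)]]) blast

text \<open>The competitor is the affine image of the potential that vanishes where the potential
  equals its bound \<open>B s\<close> and is at least \<open>1\<close> near the sphere of radius \<open>r\<close>.\<close>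

lemma harmonic_measure_le:
  assumes r: "8 * s \<le> r" and z: "z \<in> \<Omega>" "cmod (z - w) \<le> s"
    and \<epsilon>: "\<epsilon> * (B s - ln (2 / r)) \<le> ln (r / (6 * s))"
  shows "w_ar \<Omega> w r z \<le> 1 - \<epsilon>"
proof -
  define U where "U = \<Omega> \<inter> ball w r"
  \<comment> \<open>An upper bound for the potential near the sphere of radius \<open>r\<close>,
    where all masses are more than \<open>r / 2\<close> away.\<close>
  define m where "m = ln (2 / r)"
  define v where "v x = 1 - (limit_pot w s x - m) / (B s - m)" for x
  have r0: "r > 0" using r s by simp
  \<comment> \<open>Within distance \<open>s\<close> of \<open>w\<close>, every mass is at distance
    at most \<open>3 * s\<close>.\<close>
  have "- ln (3 * s) \<le> - ln (cmod (z - w) + 2 * s)"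
    using z s norm_ge_zero[of "z - w"] by (simp del: norm_ge_zero)
  also have "\<dots> \<le> limit_pot w s z" using limit_pot_ge[OF z(1)] .
  finally have pz: "- ln (3 * s) \<le> limit_pot w s z" .
  \<comment> \<open>So \<open>ln (r / (6 * s))\<close> bounds from below the excess of the potential
    at \<open>z\<close> over \<open>m\<close>; its ratio to \<open>B s - m\<close> limits the
    admissible \<open>\<epsilon>\<close>.\<close>
  have split: "ln (r / (6 * s)) = - ln (3 * s) - m"
  proof -
    have "ln (r / (6 * s)) = ln ((r / 2) / (3 * s))" by simp
    also have "\<dots> = ln (r / 2) - ln (3 * s)" using r0 s by (intro ln_divide_pos) auto
    also have "ln (r / 2) = - m" using r0 by (simp add: m_def ln_div)
    finally show ?thesis by simp
  qed
  have "ln (r / (6 * s)) > 0" using r s by simp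
  then have D: "B s - m > 0" using split pz limit_pot_le[OF z(1)] by linarith
  have zU: "z \<in> U" using z r s by (simp add: U_def dist_norm norm_minus_commute)
  have v0: "0 \<le> v x" if "x \<in> \<Omega>" for x
    using limit_pot_le[OF that] D by (simp add: v_def)
  have cont: "isCont v x" if "x \<in> \<Omega>" for x
    unfolding v_def using D by (intro continuous_intros isCont_limit_pot that) auto
  have "nonneg_superharmonic_on U v"
    unfolding nonneg_superharmonic_on_def
  proof (intro conjI ballI allI impI)
    fix x assume "x \<in> U"
    then show "0 \<le> v x" using v0 by (simp add: U_def)
  next
    fix x and e :: real assume "x \<in> U" "e > 0"
    then have "(v \<longlongrightarrow> v x) (at x within U)"
      by (intro tendsto_within_subset[OF cont[of x, unfolded isCont_def]]) (auto simp: U_def)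
    then show "\<forall>\<^sub>F y in at x within U. v x - e < v y"
      using \<open>e > 0\<close> by (intro order_tendstoD) auto
  next
    fix x R assume *: "0 < R \<and> cball x R \<subseteq> U"
    then have R: "0 < R" "cball x R \<subseteq> \<Omega>" by (auto simp: U_def)
    have circ: "x + of_real R * cis t \<in> \<Omega>" for t
      using R by (intro subsetD[OF R(2)]) (simp add: dist_norm norm_mult)
    have "((\<lambda>t. 1 - (limit_pot w s (x + of_real R * cis t) - m) / (B s - m)) has_integral
        2 * pi - (2 * pi * limit_pot w s x - 2 * pi * m) / (B s - m)) {0..2*pi}"
      using has_integral_const_real[of "1::real" 0 "2*pi"] has_integral_const_real[of m 0 "2*pi"]
      by (intro has_integral_diff has_integral_divide limit_pot_circle_mean R) auto
    moreover have "2 * pi - (2 * pi * limit_pot w s x - 2 * pi * m) / (B s - m) = 2 * pi * v x"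
      using D by (simp add: v_def field_simps)
    ultimately have "((\<lambda>t. v (x + of_real R * cis t)) has_integral 2 * pi * v x) {0..2*pi}"
      by (simp add: v_def)
    then show "(\<integral>\<^sup>+ t. ennreal (v (x + complex_of_real R * cis t)) * indicator {0..2*pi} t \<partial>lborel)
        \<le> ennreal (2 * pi * v x)"
      using v0[OF circ] by (subst nn_integral_has_integral_lebesgue') auto
  qed
  moreover have "\<forall>\<^sub>F y in at \<zeta> within U. indicator (\<Omega> \<inter> sphere w r) \<zeta> - e < v y" if "e > 0" for \<zeta> e
  proof (cases "\<zeta> \<in> \<Omega> \<inter> sphere w r")
    case True
    \<comment> \<open>Since \<open>8 * s \<le> r\<close>, the right side is at most
      \<open>3 * r / 4\<close>; the strict inequality persists nearby.\<close>
    then have "cmod (\<zeta> - w) > r / 2 + 2 * s"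
      using r s by (simp add: dist_norm norm_minus_commute)
    moreover have "((\<lambda>y. cmod (y - w)) \<longlongrightarrow> cmod (\<zeta> - w)) (at \<zeta> within U)"
      by (intro tendsto_intros)
    ultimately have "\<forall>\<^sub>F y in at \<zeta> within U. r / 2 + 2 * s < cmod (y - w)"
      by (intro order_tendstoD)
    moreover have "\<forall>\<^sub>F y in at \<zeta> within U. y \<in> U" by (simp add: eventually_at_filter)
    ultimately show ?thesis
    proof eventually_elim
      case (elim y)
      have "limit_pot w s y \<le> - ln (cmod (y - w) - 2 * s)"
        using elim r0 by (intro limit_pot_le_far) (auto simp: U_def)
      also have "\<dots> \<le> - ln (r / 2)" using elim r0 by simp
      also have "\<dots> = m" using r0 by (simp add: m_def ln_div)
      finally have "1 \<le> v y" using D by (simp add: v_def divide_le_0_iff)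
      then show ?case using True that by simp
    qed
  next
    \<comment> \<open>Elsewhere on the boundary the prescribed value is 0, so
      \<open>v \<ge> 0\<close> suffices whether or not \<open>v\<close> has a limit there.\<close>
    case False
    have "\<forall>\<^sub>F y in at \<zeta> within U. y \<in> U" by (simp add: eventually_at_filter)
    then show ?thesis
    proof eventually_elim
      case (elim y)
      then show ?case using False that v0[of y] by (simp add: U_def)
    qed
  qed
  ultimately have v: "v \<in> perron_upper U (\<Omega> \<inter> sphere w r)"
    by (simp add: perron_upper_def)
  have "bdd_below ((\<lambda>v. v z) ` perron_upper U (\<Omega> \<inter> sphere w r))"
    using zU by (intro bdd_belowI2[of _ 0]) (auto simp: perron_upper_def nonneg_superharmonic_on_def)
  from cINF_lower[OF this v] have "w_ar \<Omega> w r z \<le> v z"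
    using zU by (simp add: w_ar_def harmonic_measure_def U_def)
  also have "\<epsilon> * (B s - m) \<le> limit_pot w s z - m"
    using \<epsilon> split pz by (simp add: m_def)
  then have "v z \<le> 1 - \<epsilon>" using D by (simp add: v_def field_simps)
  finally show ?thesis .
qed

end

end

section \<open>Power and logarithmic scales\<close>

text \<open>Turns smallness conditions on \<open>r\<close> into growth conditions on
  \<open>L = ln (1 / r)\<close>, to be checked at infinity.\<close>

lemma eventually_ln_inverse_radius:
  assumes "\<forall>\<^sub>F L in at_top. P L"
  obtains r0 :: real where "0 < r0" "r0 \<le> 1" "\<And>r. 0 < r \<Longrightarrow> r < r0 \<Longrightarrow> P (ln (1 / r))"
proof -
  have "filterlim (\<lambda>r::real. ln (1 / r)) at_top (at_right 0)" by real_asymp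
  with assms have "\<forall>\<^sub>F r in at_right 0. P (ln (1 / r))" by (rule eventually_compose_filterlim)
  then obtain b where "b > 0" "\<And>r. 0 < r \<Longrightarrow> r < b \<Longrightarrow> P (ln (1 / r))"
    by (auto simp: eventually_at_right_field)
  then show ?thesis by (intro that[of "min b 1"]) auto
qed

text \<open>Two points at distance \<open>d\<close> do not fit into a ball of radius below
  \<open>d / 2\<close>. The threshold is independent of the centre, so it serves all boundary points
  at once.\<close>

lemma open_not_subset_small_ball:
  fixes \<Omega> :: "complex set"
  assumes "open \<Omega>" "\<Omega> \<noteq> {}"
  obtains e where "0 < e" "\<And>a \<rho>. \<rho> < e \<Longrightarrow> \<not> \<Omega> \<subseteq> ball a \<rho>"
proof -
  obtain x d where x: "d > 0" "cball x d \<subseteq> \<Omega>" using assms open_contains_cball by blast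
  have "\<not> \<Omega> \<subseteq> ball a \<rho>" if "\<rho> < d / 2" for a \<rho>
  proof
    assume "\<Omega> \<subseteq> ball a \<rho>"
    moreover have "x \<in> cball x d" "x + of_real d \<in> cball x d" using x(1) by (auto simp: dist_norm)
    ultimately have "x \<in> ball a \<rho>" "x + of_real d \<in> ball a \<rho>" using x(2) by blast+
    then have "dist a x < \<rho>" "dist a (x + of_real d) < \<rho>" by (simp_all only: mem_ball)
    then have "dist x (x + of_real d) < 2 * \<rho>" using dist_triangle3[of x "x + of_real d" a] by linarith
    then show False using that x(1) by (simp add: dist_norm)
  qed
  with x(1) show ?thesis by (intro that[of "d / 2"]) auto
qed

text \<open>Common to both scales, with \<open>X = ln (1 / r)\<close> or
  \<open>X = ln (ln (1 / r))\<close>. Up to \<open>ln C\<close>, the logarithmic drop from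
  \<open>r\<close> to \<open>h\<close> is \<open>q * X\<close>; the drop to \<open>\<rho>\<close> is
  \<open>2 / \<epsilon>\<close> times as large, and the factor 2 absorbs \<open>C\<close>.\<close>

lemma annulus_radii:
  fixes C \<epsilon> q X r \<rho> h :: real
  assumes pos: "0 < r" "0 < \<rho>" "0 < h" and \<epsilon>: "0 < \<epsilon>" "\<epsilon> < 1"
    and \<rho>: "ln \<rho> = ln r - 2 * q / \<epsilon> * X" and h: "ln h = ln C + ln r - q * X"
    and X: "\<bar>ln C\<bar> < q * X"
  shows "\<rho> < h" "h < r" "ln (r / h) < \<epsilon> * ln (r / \<rho>)"
proof -
  have "q * X * \<epsilon> \<le> q * X * 1" using X \<epsilon> by (intro mult_left_mono) auto
  then have "2 * (q * X) \<le> 2 * (q * X) / \<epsilon>" using \<epsilon> by (simp add: le_divide_eq)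
  then have "ln \<rho> < ln h" using \<rho> h X by simp
  then show "\<rho> < h" using pos by simp
  have "ln h < ln r" using h X by simp
  then show "h < r" using pos by simp
  have "\<epsilon> * ln (r / \<rho>) = 2 * (q * X)" using \<rho> pos \<epsilon> by (simp add: ln_div)
  moreover have "ln (r / h) = q * X - ln C" using h pos by (simp add: ln_div)
  ultimately show "ln (r / h) < \<epsilon> * ln (r / \<rho>)" using X by linarith
qed

lemma ln_h1: "0 < r \<Longrightarrow> ln (h1 \<alpha> r) = \<alpha> * ln r"
  by (simp add: h1_def ln_powr)

lemma ln_h2: "0 < r \<Longrightarrow> 0 < ln (1 / r) \<Longrightarrow> ln (h2 \<beta> r) = ln r - \<beta> * ln (ln (1 / r))"
  by (simp add: h2_def ln_mult ln_powr)

lemma h2_pos: "0 < r \<Longrightarrow> 0 < ln (1 / r) \<Longrightarrow> 0 < h2 \<beta> r"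
  by (simp add: h2_def)

lemma mono_on_h1: "0 \<le> \<alpha> \<Longrightarrow> mono_on {0..<r0} (h1 \<alpha>)"
  by (auto simp: h1_def intro!: mono_onI powr_mono2)

lemma h1_le_self:
  assumes "1 \<le> \<alpha>" "0 \<le> r" "r \<le> 1"
  shows "h1 \<alpha> r \<le> r"
  using powr_mono'[of 1 \<alpha> r] assms by (simp add: h1_def)

lemma mono_on_h2:
  assumes "0 \<le> \<beta>" "\<And>r. 0 < r \<Longrightarrow> r < r0 \<Longrightarrow> 0 < ln (1 / r)"
  shows "mono_on {0..<r0} (h2 \<beta>)"
proof (rule mono_onI)
  fix x y assume xy: "x \<in> {0..<r0}" "y \<in> {0..<r0}" "x \<le> y"
  show "h2 \<beta> x \<le> h2 \<beta> y"
  \<comment> \<open>At 0 the factor \<open>r\<close> alone decides the value, so the convention for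
    \<open>ln (1 / 0)\<close> is harmless.\<close>
  proof (cases "x = 0")
    case True
    then show ?thesis using xy by (simp add: h2_def)
  next
    case False
    then have "ln (1 / y) \<le> ln (1 / x)" "0 < ln (1 / y)"
      using xy assms(2)[of y] by (auto simp: ln_div)
    then have "ln (1 / x) powr (- \<beta>) \<le> ln (1 / y) powr (- \<beta>)"
      using assms(1) by (intro powr_mono2') auto
    then show ?thesis unfolding h2_def using xy by (intro mult_mono) auto
  qed
qed

lemma h2_le_self:
  assumes "0 \<le> \<beta>" "0 \<le> r" "0 < r \<Longrightarrow> 1 \<le> ln (1 / r)"
  shows "h2 \<beta> r \<le> r"
proof (cases "r = 0")
  case False
  then have "ln (1 / r) powr (- \<beta>) \<le> ln (1 / r) powr 0"
    using assms by (intro powr_mono) auto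
  then have "ln (1 / r) powr (- \<beta>) \<le> 1" using False assms by (simp split: if_splits)
  then show ?thesis using assms by (simp add: h2_def mult_left_le)
qed (simp add: h2_def)

section \<open>From harmonic measure to uniform perfectness\<close>

lemma cond_U1_of_Delta1:
  assumes \<Omega>: "open \<Omega>" "connected \<Omega>" "\<Omega> \<noteq> {}" and \<alpha>': "1 < \<alpha>'" and D: "cond_Delta1 \<Omega> \<alpha>'"
  shows "\<exists>\<alpha>>1. cond_U1 (frontier \<Omega>) \<alpha>"
proof -
  obtain C \<epsilon> r1 where C: "C > 0" and \<epsilon>: "0 < \<epsilon>" "\<epsilon> < 1" and r1: "r1 > 0"
    and w: "\<And>a r z. a \<in> frontier \<Omega> \<Longrightarrow> r \<in> {0<..<r1} \<Longrightarrow> z \<in> \<Omega> \<inter> sphere a (C * h1 \<alpha>' r)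
      \<Longrightarrow> w_ar \<Omega> a r z \<le> 1 - \<epsilon>"
    using D unfolding cond_Delta1_def cond_Delta_def by blast
  obtain e where e: "0 < e" "\<And>a \<rho>. \<rho> < e \<Longrightarrow> \<not> \<Omega> \<subseteq> ball a \<rho>"
    by (rule open_not_subset_small_ball[OF \<Omega>(1,3)]) blast
  have "\<forall>\<^sub>F L in at_top. \<bar>ln C\<bar> / (\<alpha>' - 1) < L" by (rule eventually_gt_at_top)
  then obtain r2 where r2: "0 < r2" "r2 \<le> 1"
    "\<And>r. 0 < r \<Longrightarrow> r < r2 \<Longrightarrow> \<bar>ln C\<bar> / (\<alpha>' - 1) < ln (1 / r)"
    by (rule eventually_ln_inverse_radius) blast
  \<comment> \<open>Puts \<open>r powr \<alpha>\<close> into the form required by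
    \<open>annulus_radii\<close>, with \<open>q = \<alpha>' - 1\<close> and
    \<open>X = - ln r\<close>.\<close>
  define \<alpha> where "\<alpha> = 1 + 2 * (\<alpha>' - 1) / \<epsilon>"
  define r0 where "r0 = min (min r1 r2) e"
  have \<alpha>: "1 < \<alpha>" using \<alpha>' \<epsilon> by (simp add: \<alpha>_def)
  have r0: "r0 > 0" "r0 \<le> 1" using r1 r2 e by (auto simp: r0_def)
  have "\<exists>z\<in>frontier \<Omega>. 1 * h1 \<alpha> r \<le> cmod (z - a) \<and> cmod (z - a) \<le> r"
    if a: "a \<in> frontier \<Omega>" and r: "r \<in> {0<..<r0}" for a r
  proof -
    have r': "0 < r" "r < r1" "r < r2" "r < e" "r < 1" using r r0 by (auto simp: r0_def)
    have pos: "0 < h1 \<alpha> r" "0 < C * h1 \<alpha>' r" using r' C by (auto simp: h1_def)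
    have L: "\<bar>ln C\<bar> < (\<alpha>' - 1) * (- ln r)"
      using r2(3)[OF r'(1,3)] \<alpha>' r' by (simp add: field_simps ln_div)
    have "ln (h1 \<alpha> r) = ln r - 2 * (\<alpha>' - 1) / \<epsilon> * (- ln r)"
      using r' \<epsilon> by (simp add: ln_h1 \<alpha>_def field_simps)
    moreover have "ln (C * h1 \<alpha>' r) = ln C + ln r - (\<alpha>' - 1) * (- ln r)"
      using r' C zero_less_mult_pos[OF pos(2) C] by (simp add: ln_mult ln_h1 algebra_simps)
    ultimately have rad: "h1 \<alpha> r < C * h1 \<alpha>' r" "C * h1 \<alpha>' r < r"
      "ln (r / (C * h1 \<alpha>' r)) < \<epsilon> * ln (r / h1 \<alpha> r)"
      using annulus_radii[OF r'(1) pos \<epsilon> _ _ L] by blast+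
    have "\<not> \<Omega> \<subseteq> ball a (h1 \<alpha> r)" using rad r' by (intro e) auto
    from frontier_meets_annulus_of_harmonic_measure[OF \<Omega>(1,2) a this pos(1) rad(1,2) w[OF a] rad(3)]
    show ?thesis using r' by simp
  qed
  moreover have "mono_on {0..<r0} (\<lambda>r. 1 * h1 \<alpha> r)" using mono_on_h1[of \<alpha> r0] \<alpha> by simp
  moreover have "\<forall>r\<in>{0..<r0}. 1 * h1 \<alpha> r \<le> r" using h1_le_self[of \<alpha>] \<alpha> r0 by simp
  ultimately have "h_uniformly_perfect (\<lambda>r. 1 * h1 \<alpha> r) r0 (frontier \<Omega>)"
    by (simp add: h_uniformly_perfect_def)
  then have "cond_U1 (frontier \<Omega>) \<alpha>" unfolding cond_U1_def using r0 zero_less_one by blast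
  then show ?thesis using \<alpha> by blast
qed

lemma cond_U2_of_Delta2:
  assumes \<Omega>: "open \<Omega>" "connected \<Omega>" "\<Omega> \<noteq> {}" and \<beta>': "0 < \<beta>'" and D: "cond_Delta2 \<Omega> \<beta>'"
  shows "\<exists>\<beta>>0. cond_U2 (frontier \<Omega>) \<beta>"
proof -
  obtain C \<epsilon> r1 where C: "C > 0" and \<epsilon>: "0 < \<epsilon>" "\<epsilon> < 1" and r1: "r1 > 0"
    and w: "\<And>a r z. a \<in> frontier \<Omega> \<Longrightarrow> r \<in> {0<..<r1} \<Longrightarrow> z \<in> \<Omega> \<inter> sphere a (C * h2 \<beta>' r)
      \<Longrightarrow> w_ar \<Omega> a r z \<le> 1 - \<epsilon>"
    using D unfolding cond_Delta2_def cond_Delta_def by blast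
  obtain e where e: "0 < e" "\<And>a \<rho>. \<rho> < e \<Longrightarrow> \<not> \<Omega> \<subseteq> ball a \<rho>"
    by (rule open_not_subset_small_ball[OF \<Omega>(1,3)]) blast
  have "\<forall>\<^sub>F L in at_top. exp (\<bar>ln C\<bar> / \<beta>') < L \<and> 1 \<le> L"
    by (intro eventually_conj eventually_gt_at_top eventually_ge_at_top)
  \<comment> \<open>With \<open>L = ln (1 / r)\<close>, the first bound gives
    \<open>\<bar>ln C\<bar> < \<beta>' * ln L\<close> and the second
    \<open>h2 \<beta> r \<le> r\<close>.\<close>
  then obtain r2 where r2: "0 < r2" "r2 \<le> 1"
    "\<And>r. 0 < r \<Longrightarrow> r < r2 \<Longrightarrow> exp (\<bar>ln C\<bar> / \<beta>') < ln (1 / r) \<and> 1 \<le> ln (1 / r)"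
    by (rule eventually_ln_inverse_radius) blast
  \<comment> \<open>Matches \<open>annulus_radii\<close> with \<open>q = \<beta>'\<close> and
    \<open>X = ln L\<close>.\<close>
  define \<beta> where "\<beta> = 2 * \<beta>' / \<epsilon>"
  define r0 where "r0 = min (min r1 r2) e"
  have \<beta>: "0 < \<beta>" using \<beta>' \<epsilon> by (simp add: \<beta>_def)
  have r0: "r0 > 0" "r0 \<le> r2" using r1 r2 e by (auto simp: r0_def)
  have "\<exists>z\<in>frontier \<Omega>. 1 * h2 \<beta> r \<le> cmod (z - a) \<and> cmod (z - a) \<le> r"
    if a: "a \<in> frontier \<Omega>" and r: "r \<in> {0<..<r0}" for a r
  proof -
    have r': "0 < r" "r < r1" "r < r2" "r < e" using r by (auto simp: r0_def)
    define L where "L = ln (1 / r)"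
    have L: "exp (\<bar>ln C\<bar> / \<beta>') < L" "1 \<le> L" using r2(3)[OF r'(1,3)] by (auto simp: L_def)
    have "0 < ln (1 / r)" using L unfolding L_def by linarith
    note h2_pos = h2_pos[OF r'(1) this]
    have pos: "0 < h2 \<beta> r" "0 < C * h2 \<beta>' r" using C h2_pos by auto
    have "\<bar>ln C\<bar> / \<beta>' < ln L" using L by (metis exp_gt_zero ln_exp ln_less_cancel_iff less_trans)
    then have lnL: "\<bar>ln C\<bar> < \<beta>' * ln L" using \<beta>' by (simp add: field_simps)
    have "ln (h2 \<beta> r) = ln r - 2 * \<beta>' / \<epsilon> * ln L"
      using ln_h2[OF r'(1) \<open>0 < ln (1 / r)\<close>] by (simp add: \<beta>_def L_def)
    moreover have "ln (C * h2 \<beta>' r) = ln C + ln r - \<beta>' * ln L"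
      using r' C \<open>0 < ln (1 / r)\<close> h2_pos[of \<beta>'] by (simp add: ln_mult ln_h2 L_def del: ln_gt_zero_iff)
    ultimately have rad: "h2 \<beta> r < C * h2 \<beta>' r" "C * h2 \<beta>' r < r"
      "ln (r / (C * h2 \<beta>' r)) < \<epsilon> * ln (r / h2 \<beta> r)"
      using annulus_radii[OF r'(1) pos \<epsilon> _ _ lnL] by blast+
    have "\<not> \<Omega> \<subseteq> ball a (h2 \<beta> r)" using rad r' by (intro e) auto
    from frontier_meets_annulus_of_harmonic_measure[OF \<Omega>(1,2) a this pos(1) rad(1,2) w[OF a] rad(3)]
    show ?thesis using r' by simp
  qed
  moreover have ln1: "1 \<le> ln (1 / r)" if "0 < r" "r < r0" for r using r2(3)[of r] r0 that by simp
  have "0 < ln (1 / r)" if "0 < r" "r < r0" for r using ln1[OF that] by linarith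
  then have "mono_on {0..<r0} (\<lambda>r. 1 * h2 \<beta> r)"
    unfolding mult_1 using \<beta> by (intro mono_on_h2) auto
  moreover have "\<forall>r\<in>{0..<r0}. 1 * h2 \<beta> r \<le> r" using h2_le_self[of \<beta>] \<beta> ln1 by simp
  ultimately have "h_uniformly_perfect (\<lambda>r. 1 * h2 \<beta> r) r0 (frontier \<Omega>)"
    by (simp add: h_uniformly_perfect_def)
  then have "cond_U2 (frontier \<Omega>) \<beta>" unfolding cond_U2_def using r0 zero_less_one by blast
  then show ?thesis using \<beta> by blast
qed

section \<open>From uniform perfectness to harmonic measure\<close>

lemma cond_Delta_of_perfect:
  assumes \<Omega>: "open \<Omega>" and R: "0 < R" and \<epsilon>: "0 < \<epsilon>" "\<epsilon> < 1"
    and perfect: "\<And>a s. a \<in> frontier \<Omega> \<Longrightarrow> 0 < s \<Longrightarrow> s < \<sigma> \<Longrightarrow>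
        \<exists>z\<in>frontier \<Omega>. h s \<le> cmod (z - a) \<and> cmod (z - a) \<le> s"
    and h: "\<And>s. 0 < s \<Longrightarrow> s < \<sigma> \<Longrightarrow> 0 < h s \<and> h s \<le> s"
    and B: "\<And>s. 0 < s \<Longrightarrow> s < \<sigma> \<Longrightarrow> 0 \<le> B s \<and> (ln (4 / h s) + B (h s / 8)) / 2 \<le> B s"
    and k: "\<And>r. 0 < r \<Longrightarrow> r < R \<Longrightarrow> 0 < k r \<and> k r < \<sigma> \<and> 8 * k r \<le> r \<and>
        \<epsilon> * (B (k r) - ln (2 / r)) \<le> ln (r / (6 * k r))"
  shows "cond_Delta k \<Omega>"
proof -
  define c where "c a s = (SOME z. z \<in> frontier \<Omega> \<and> h s \<le> cmod (z - a) \<and> cmod (z - a) \<le> s)" for a s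
  have c: "c a s \<in> frontier \<Omega> \<and> h s \<le> cmod (c a s - a) \<and> cmod (c a s - a) \<le> s"
    if "a \<in> frontier \<Omega>" "0 < s" "s < \<sigma>" for a s
  proof -
    have "\<exists>z. z \<in> frontier \<Omega> \<and> h s \<le> cmod (z - a) \<and> cmod (z - a) \<le> s"
      using perfect[OF that] by blast
    from someI_ex[OF this] show ?thesis unfolding c_def .
  qed
  interpret cantor_potential "frontier \<Omega>" h \<sigma> c B
    by unfold_locales (use h c B in blast)+
  have disj: "\<Omega> \<inter> frontier \<Omega> = {}" using \<Omega> by (auto simp: frontier_def interior_open)
  have "w_ar \<Omega> a r z \<le> 1 - \<epsilon>"
    if "a \<in> frontier \<Omega>" "r \<in> {0<..<R}" "z \<in> \<Omega> \<inter> sphere a (k r)" for a r z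
  proof -
    \<comment> \<open>The Cantor construction starts at \<open>a\<close> with scale
      \<open>k r\<close>, matching the circle on which the harmonic measure is estimated;
      \<open>h\<close> governs its splitting.\<close>
    have kr: "0 < k r" "k r < \<sigma>" "8 * k r \<le> r" "\<epsilon> * (B (k r) - ln (2 / r)) \<le> ln (r / (6 * k r))"
      using k[of r] that(2) by auto
    show ?thesis
      by (rule harmonic_measure_le[OF \<Omega> disj that(1) kr(1,2,3) _ _ kr(4)])
         (use that(3) in \<open>auto simp: dist_norm norm_minus_commute\<close>)
  qed
  then show ?thesis unfolding cond_Delta_def using \<epsilon> R by blast
qed

text \<open>The exponent 2 serves every \<open>\<alpha> < 2\<close>; the dependence on
  \<open>\<alpha>\<close> goes into \<open>\<epsilon>\<close> and the range of radii.\<close>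

lemma cond_Delta1_of_U1:
  assumes \<Omega>: "open \<Omega>" and \<alpha>: "1 < \<alpha>" "\<alpha> < 2" and U: "cond_U1 (frontier \<Omega>) \<alpha>"
  shows "cond_Delta1 \<Omega> 2"
proof -
  obtain C r1 where C: "C > 0" and r1: "r1 > 0"
    and le: "\<And>s. s \<in> {0..<r1} \<Longrightarrow> C * h1 \<alpha> s \<le> s"
    and perf: "\<And>a s. a \<in> frontier \<Omega> \<Longrightarrow> s \<in> {0<..<r1} \<Longrightarrow>
        \<exists>z\<in>frontier \<Omega>. C * h1 \<alpha> s \<le> cmod (z - a) \<and> cmod (z - a) \<le> s"
    using U unfolding cond_U1_def h_uniformly_perfect_def by blast
  \<comment> \<open>Room between \<open>\<alpha>\<close> and 2: for small \<open>s\<close> the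
    factor \<open>8 / C\<close> is absorbed by \<open>s powr (\<alpha> - q)\<close>.\<close>
  define q where "q = (\<alpha> + 2) / 2"
  have q: "\<alpha> < q" "q < 2" "3 / 2 < q" using \<alpha> by (auto simp: q_def)
  \<comment> \<open>The solution of \<open>(1 + A) * q = 2 * A\<close>, which makes
    \<open>A * ln (1 / s)\<close> a supersolution of the recursion; its positivity rests on
    \<open>q < 2\<close>.\<close>
  define A where "A = q / (2 - q)"
  have A: "1 < A" "(1 + A) * q = 2 * A" using q by (auto simp: A_def field_simps)
  have "\<forall>\<^sub>F L in at_top. ln (8 / C) / (q - \<alpha>) \<le> L \<and> 2 * ln 6 \<le> L"
    by (intro eventually_conj eventually_ge_at_top)
  \<comment> \<open>The first bound absorbs the constants; the second gives
    \<open>L - ln 6 \<ge> L / 2\<close> in the final estimate.\<close>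
  then obtain r2 where r2: "0 < r2" "r2 \<le> 1"
    "\<And>r. 0 < r \<Longrightarrow> r < r2 \<Longrightarrow> ln (8 / C) / (q - \<alpha>) \<le> ln (1 / r) \<and> 2 * ln 6 \<le> ln (1 / r)"
    by (rule eventually_ln_inverse_radius) blast
  define s0 where "s0 = min r1 r2"
  define r0 where "r0 = min s0 (1 / 8)"
  have s0: "s0 \<le> r1" "s0 \<le> r2" "s0 \<le> 1" using r2 by (auto simp: s0_def)
  have "cond_Delta (\<lambda>r. 1 * h1 2 r) \<Omega>"
  \<comment> \<open>At scale \<open>r * r\<close> the bound \<open>B\<close> equals
    \<open>2 * A * L\<close> with \<open>L = ln (1 / r)\<close>, so this \<open>\<epsilon>\<close>
    turns it into \<open>L / 2\<close>.\<close>
  proof (rule cond_Delta_of_perfect[where h = "\<lambda>s. C * h1 \<alpha> s" and B = "\<lambda>s. A * ln (1 / s)"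
        and \<sigma> = s0 and R = r0 and \<epsilon> = "1 / (4 * A)", OF \<Omega>])
    show "0 < r0" using r1 r2 by (simp add: r0_def s0_def)
    show "0 < 1 / (4 * A)" "1 / (4 * A) < 1" using A by auto
    show "\<exists>z\<in>frontier \<Omega>. C * h1 \<alpha> s \<le> cmod (z - a) \<and> cmod (z - a) \<le> s"
      if "a \<in> frontier \<Omega>" "0 < s" "s < s0" for a s using perf that s0 by simp
    show "0 < C * h1 \<alpha> s \<and> C * h1 \<alpha> s \<le> s" if "0 < s" "s < s0" for s
      using le[of s] that s0 C by (simp add: h1_def)
    show "0 \<le> A * ln (1 / s) \<and>
        (ln (4 / (C * h1 \<alpha> s)) + A * ln (1 / (C * h1 \<alpha> s / 8))) / 2 \<le> A * ln (1 / s)"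
      if s: "0 < s" "s < s0" for s
    proof
      define L where "L = ln (1 / s)"
      have L: "0 < L" "ln s = - L" "ln (8 / C) \<le> (q - \<alpha>) * L"
        using s s0 q r2(3)[of s] by (auto simp: L_def ln_div field_simps)
      show "0 \<le> A * ln (1 / s)" using A L(1) unfolding L_def by (intro mult_nonneg_nonneg) auto
      have pos: "0 < C * h1 \<alpha> s" using C s by (simp add: h1_def)
      define L' where "L' = ln (8 / (C * h1 \<alpha> s))"
      have "L' = ln (8 / C) + \<alpha> * L"
        using C s L zero_less_mult_pos[OF pos C] by (simp add: L'_def ln_div ln_mult ln_h1)
      then have L': "L' \<le> q * L" using L by (simp add: algebra_simps)
      have "ln (4 / (C * h1 \<alpha> s)) \<le> L'"
        unfolding L'_def using pos by (intro ln_mono divide_right_mono) auto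
      moreover have "ln (1 / (C * h1 \<alpha> s / 8)) = L'" by (simp add: L'_def)
      ultimately have "ln (4 / (C * h1 \<alpha> s)) + A * ln (1 / (C * h1 \<alpha> s / 8)) \<le> (1 + A) * L'"
        by (simp add: algebra_simps)
      also have "\<dots> \<le> (1 + A) * (q * L)" using L' A by (intro mult_left_mono) auto
      also have "\<dots> = 2 * (A * L)" using A(2) by (simp add: mult.assoc[symmetric])
      finally show "(ln (4 / (C * h1 \<alpha> s)) + A * ln (1 / (C * h1 \<alpha> s / 8))) / 2 \<le> A * ln (1 / s)"
        by (simp add: L_def)
    qed
    show "0 < 1 * h1 2 r \<and> 1 * h1 2 r < s0 \<and> 8 * (1 * h1 2 r) \<le> r \<and>
        1 / (4 * A) * (A * ln (1 / (1 * h1 2 r)) - ln (2 / r)) \<le> ln (r / (6 * (1 * h1 2 r)))"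
      if "0 < r" "r < r0" for r
    proof -
      have r: "0 < r" "r < s0" "r < 1 / 8" using that by (auto simp: r0_def)
      have h: "h1 2 r = r * r" using r by (simp add: h1_def power2_eq_square)
      have "r * r \<le> r * (1 / 8)" using r by (intro mult_left_mono) auto
      then have sm: "8 * (r * r) \<le> r" "r * r < s0" using r by linarith+
      define L where "L = ln (1 / r)"
      have L: "2 * ln 6 \<le> L" "ln r = - L" using r2(3)[of r] r s0 by (auto simp: L_def ln_div)
      have "(0::real) \<le> ln 6" by simp
      then have "0 \<le> L" using L by linarith
      have "1 / (4 * A) * (A * ln (1 / (r * r)) - ln (2 / r)) = L / 2 - (ln 2 + L) / (4 * A)"
        using r L A by (simp add: ln_div ln_mult field_simps)
      also have "\<dots> \<le> L / 2"
      proof -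
        have "0 \<le> (ln 2 + L) / (4 * A)"
          using A \<open>0 \<le> L\<close> by (intro divide_nonneg_nonneg add_nonneg_nonneg) auto
        then show ?thesis by linarith
      qed
      also have "\<dots> \<le> L - ln 6" using L by simp
      also have "\<dots> = ln (r / (6 * (r * r)))" using r L by (simp add: ln_div ln_mult)
      finally show ?thesis using r sm by (simp add: h)
    qed
  qed
  then show ?thesis unfolding cond_Delta1_def using zero_less_one by blast
qed

text \<open>For every \<open>\<beta>\<close> a supersolution is \<open>ln (1 / s)\<close> plus a
  multiple of its logarithm. Its leading term cancels against \<open>ln (2 / r)\<close>, so only
  iterated logarithms have to be compared.\<close>

lemma cond_Delta2_of_U2:
  assumes \<Omega>: "open \<Omega>" and \<beta>: "0 < \<beta>" and U: "cond_U2 (frontier \<Omega>) \<beta>"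
  shows "cond_Delta2 \<Omega> 1"
proof -
  obtain C r1 where C: "C > 0" and r1: "r1 > 0"
    and le: "\<And>s. s \<in> {0..<r1} \<Longrightarrow> C * h2 \<beta> s \<le> s"
    and perf: "\<And>a s. a \<in> frontier \<Omega> \<Longrightarrow> s \<in> {0<..<r1} \<Longrightarrow>
        \<exists>z\<in>frontier \<Omega>. C * h2 \<beta> s \<le> cmod (z - a) \<and> cmod (z - a) \<le> s"
    using U unfolding cond_U2_def h_uniformly_perfect_def by blast
  define c where "c = ln (8 / C)"
  \<comment> \<open>Of the available \<open>2 * (\<beta> + 1)\<close> multiples of
    \<open>ln L\<close>, the recursion consumes \<open>\<beta>\<close> through \<open>L'\<close> and
    \<open>\<beta> + 1\<close> through \<open>B\<close>, leaving one for the constants.\<close>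
  define A where "A = 2 * (\<beta> + 1)"
  have A: "0 < A" using \<beta> by (simp add: A_def)
  have "\<forall>\<^sub>F L in at_top. \<beta> * ln L + c \<le> L"
    using \<beta> by real_asymp
  moreover have "\<forall>\<^sub>F L in at_top. c + (\<beta> + 1) \<le> ln L"
    by real_asymp
  moreover have "\<forall>\<^sub>F L::real in at_top. 36 \<le> L" by (rule eventually_ge_at_top)
  ultimately have "\<forall>\<^sub>F L in at_top. \<beta> * ln L + c \<le> L \<and> c + (\<beta> + 1) \<le> ln L \<and> 36 \<le> L"
    by eventually_elim simp
  \<comment> \<open>The first condition yields \<open>L' \<le> 2 * L\<close>, the second pays the
    constants with the spare \<open>ln L\<close>, and \<open>36 = 6 ^ 2\<close> gives
    \<open>ln L - ln 6 \<ge> ln L / 2\<close>.\<close>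
  then obtain r2 where r2: "0 < r2" "r2 \<le> 1"
    "\<And>r. 0 < r \<Longrightarrow> r < r2 \<Longrightarrow> \<beta> * ln (ln (1 / r)) + c \<le> ln (1 / r) \<and>
        c + (\<beta> + 1) \<le> ln (ln (1 / r)) \<and> 36 \<le> ln (1 / r)"
    by (rule eventually_ln_inverse_radius) blast
  define s0 where "s0 = min r1 r2"
  have s0: "s0 \<le> r1" "s0 \<le> r2" "0 < s0" using r1 r2 by (auto simp: s0_def)
  have L36: "36 \<le> ln (1 / s)" if "0 < s" "s < s0" for s using r2(3)[of s] that s0 by simp
  have pos: "0 < C * h2 \<beta> s" if "0 < s" "s < s0" for s
  proof -
    have "0 < ln (1 / s)" using L36[OF that] by linarith
    from h2_pos[OF that(1) this] C show ?thesis by simp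
  qed
  have ln2: "ln (2::real) \<le> 1" using ln_le_minus_one[of 2] by simp
  define B where "B s = ln (1 / s) + A * ln (ln (1 / s))" for s :: real
  have "cond_Delta (\<lambda>r. 1 * h2 1 r) \<Omega>"
  \<comment> \<open>With \<open>L = ln (1 / r)\<close>, the difference
    \<open>B (r / L) - ln (2 / r)\<close> is at most \<open>(1 + 2 * A) * ln L\<close>; this
    \<open>\<epsilon>\<close> reduces it to \<open>ln L / 2\<close>.\<close>
  proof (rule cond_Delta_of_perfect[where h = "\<lambda>s. C * h2 \<beta> s" and B = B
        and \<sigma> = s0 and R = s0 and \<epsilon> = "1 / (2 * (1 + 2 * A))", OF \<Omega>])
    show "0 < s0" by fact
    show "0 < 1 / (2 * (1 + 2 * A))" "1 / (2 * (1 + 2 * A)) < 1" using A by auto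
    show "\<exists>z\<in>frontier \<Omega>. C * h2 \<beta> s \<le> cmod (z - a) \<and> cmod (z - a) \<le> s"
      if "a \<in> frontier \<Omega>" "0 < s" "s < s0" for a s using perf that s0 by simp
    show "0 < C * h2 \<beta> s \<and> C * h2 \<beta> s \<le> s" if "0 < s" "s < s0" for s
      using le[of s] that s0 pos by simp
    show "0 \<le> B s \<and> (ln (4 / (C * h2 \<beta> s)) + B (C * h2 \<beta> s / 8)) / 2 \<le> B s"
      if s: "0 < s" "s < s0" for s
    proof
      define L where "L = ln (1 / s)"
      have L: "ln s = - L" "\<beta> * ln L + c \<le> L" "c + (\<beta> + 1) \<le> ln L" "36 \<le> L"
        using s s0 r2(3)[of s] by (auto simp: L_def ln_div)
      have lnL: "0 \<le> ln L" using L by simp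
      have "0 \<le> L + A * ln L" using A L(4) lnL by (intro add_nonneg_nonneg mult_nonneg_nonneg) auto
      then show "0 \<le> B s" by (simp add: B_def L_def)
      define L' where "L' = ln (8 / (C * h2 \<beta> s))"
      have L'eq: "L' = L + (\<beta> * ln L + c)"
      proof -
        have "L' = ln 8 - (ln C + ln (h2 \<beta> s))"
          using C s pos[OF s] by (simp add: L'_def ln_div ln_mult zero_less_mult_iff)
        also have "ln (h2 \<beta> s) = ln s - \<beta> * ln L"
          using s L(4) unfolding L_def by (intro ln_h2) linarith+
        finally show ?thesis using C L by (simp add: c_def ln_div)
      qed
      \<comment> \<open>Positivity of \<open>L'\<close> comes from
        \<open>C * h2 \<beta> s \<le> s\<close>, as the sign of \<open>c\<close> is unknown.\<close>
      have "1 / s \<le> 8 / (C * h2 \<beta> s)"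
        using le[of s] s s0 pos[OF s] by (intro frac_le) auto
      then have "L \<le> L'" unfolding L_def L'_def using s by (intro ln_mono) auto
      then have L'pos: "0 < L'" using L by simp
      have "ln L' \<le> ln (2 * L)" using L'pos L L'eq by (intro ln_mono) auto
      also have "\<dots> \<le> 1 + ln L" using ln2 L by (simp add: ln_mult)
      finally have lnL': "ln L' \<le> 1 + ln L" .
      have "ln (4 / (C * h2 \<beta> s)) \<le> L'"
        unfolding L'_def using pos[OF s] by (intro ln_mono divide_right_mono) auto
      moreover have "B (C * h2 \<beta> s / 8) = L' + A * ln L'" by (simp add: L'_def B_def)
      ultimately have "(ln (4 / (C * h2 \<beta> s)) + B (C * h2 \<beta> s / 8)) / 2 \<le> L' + (\<beta> + 1) * ln L'"
        by (simp add: A_def field_simps)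
      also have "\<dots> \<le> L' + (\<beta> + 1) * (1 + ln L)"
        using lnL' \<beta> by (intro add_left_mono mult_left_mono) auto
      also have "\<dots> \<le> L + A * ln L" using L(3) by (simp add: L'eq A_def algebra_simps)
      finally show "(ln (4 / (C * h2 \<beta> s)) + B (C * h2 \<beta> s / 8)) / 2 \<le> B s"
        by (simp add: B_def L_def)
    qed
    show "0 < 1 * h2 1 r \<and> 1 * h2 1 r < s0 \<and> 8 * (1 * h2 1 r) \<le> r \<and>
        1 / (2 * (1 + 2 * A)) * (B (1 * h2 1 r) - ln (2 / r)) \<le> ln (r / (6 * (1 * h2 1 r)))"
      if r: "0 < r" "r < s0" for r
    proof -
      define L where "L = ln (1 / r)"
      have L: "36 \<le> L" "ln r = - L" using L36[OF r] r by (auto simp: L_def ln_div)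
      have h: "h2 1 r = r / L" using L by (simp add: h2_def L_def[symmetric] powr_minus_divide)
      have sm: "8 * (r / L) \<le> r" "0 < r / L" using r L by (auto simp: field_simps)
      then have "r / L < s0" using r by linarith
      note sm = sm this
      have lnk: "ln (1 / (r / L)) = L + ln L" using r L by (simp add: ln_div)
      have "2 * ln 6 = ln (36::real)" using ln_realpow[of 6 2] by simp
      also have "\<dots> \<le> ln L" using L by simp
      finally have ln6: "2 * ln 6 \<le> ln L" .
      have ln2': "ln 2 \<le> ln L" using L by simp
      have "0 \<le> ln L" using L by simp
      then have "0 < L + ln L" using L by linarith
      then have "ln (L + ln L) \<le> ln (2 * L)"
        using L ln_le_minus_one[of L] by (intro ln_mono) auto
      also have "\<dots> \<le> 2 * ln L" using L ln2' by (simp add: ln_mult)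
      finally have "A * ln (L + ln L) \<le> A * (2 * ln L)" using A by (intro mult_left_mono) auto
      moreover have "ln (2 / r) = ln 2 + L" using r L by (simp add: ln_div)
      moreover have "(0::real) \<le> ln 2" by simp
      moreover have "ln L * (1 + 2 * A) = ln L + A * (2 * ln L)" by (simp add: algebra_simps)
      ultimately have "B (r / L) - ln (2 / r) \<le> ln L * (1 + 2 * A)"
        unfolding B_def lnk by linarith
      then have "1 / (2 * (1 + 2 * A)) * (B (r / L) - ln (2 / r)) \<le>
          1 / (2 * (1 + 2 * A)) * (ln L * (1 + 2 * A))"
        using A by (intro mult_left_mono) auto
      also have "\<dots> = ln L / 2" using A by (simp add: field_simps)
      also have "\<dots> \<le> ln L - ln 6" using ln6 by simp
      also have "\<dots> = ln (L / 6)" using L by (simp add: ln_div)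
      also have "L / 6 = r / (6 * (r / L))" using r L by simp
      finally show ?thesis using sm by (simp add: h)
    qed
  qed
  then show ?thesis unfolding cond_Delta2_def using zero_less_one by blast
qed

theorem theorem1p3:
  fixes \<Omega> :: "complex set"
  assumes "open \<Omega>" and "connected \<Omega>" and "\<Omega> \<noteq> {}"
  shows "((\<exists>\<alpha>. 1 < \<alpha> \<and> \<alpha> < 2 \<and> cond_U1 (frontier \<Omega>) \<alpha>) \<longrightarrow> (\<exists>\<alpha>'>1. cond_Delta1 \<Omega> \<alpha>'))
       \<and> ((\<exists>\<alpha>'>1. cond_Delta1 \<Omega> \<alpha>') \<longrightarrow> (\<exists>\<alpha>>1. cond_U1 (frontier \<Omega>) \<alpha>))
       \<and> ((\<exists>\<beta>>0. cond_U2 (frontier \<Omega>) \<beta>) \<longleftrightarrow> (\<exists>\<beta>'>0. cond_Delta2 \<Omega> \<beta>'))"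
proof -
  have "cond_Delta1 \<Omega> 2" if "1 < \<alpha>" "\<alpha> < 2" "cond_U1 (frontier \<Omega>) \<alpha>" for \<alpha>
    using cond_Delta1_of_U1[OF assms(1) that] .
  moreover have "cond_Delta2 \<Omega> 1" if "0 < \<beta>" "cond_U2 (frontier \<Omega>) \<beta>" for \<beta>
    using cond_Delta2_of_U2[OF assms(1) that] .
  moreover have "(1::real) < 2" "(0::real) < 1" by auto
  ultimately show ?thesis
    using cond_U1_of_Delta1[OF assms] cond_U2_of_Delta2[OF assms] by blast
qed

end
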